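(* Let $(V,g)$ be a $6$-dimensional Euclidean vector space. For every $\omega\in\Lambda^3V^*$ there exists $\eta\in\Lambda^4V^*$ such that $$0\leq\mathcal{A}_\omega+\hat\eta\leq 2|\omega|^2\operatorname{id}_{\Lambda^2V}.$$
   Context: $\Lambda^2V$ is identified with $\mathfrak{so}(V)$ via $(x\wedge y)z=g(x,z)y-g(y,z)x$. If $e_1,\ldots,e_6$ is an orthonormal basis of $V$, then $\{e_{i_1}\wedge\ldots\wedge e_{i_p}\}_{i_1<\ldots<i_p}$ is orthonormal in $\Lambda^pV$, and likewise for the dual basis in $\Lambda^pV^*$. An element $\Xi\in\mathfrak{so}(V)$ acts on $p$-forms by $(\Xi\omega)(X_1,\ldots,X_p)=-\sum_{i=1}^p\omega(X_1,\ldots,\Xi X_i,\ldots,X_p)$. The action operator $\mathcal{A}_\omega\colon\Lambda^2V\to\Lambda^2V$ is defined by $g(\mathcal{A}_\omega(\alpha),\beta)=g(\alpha\omega,\beta\omega)$ for $\alpha,\beta\in\Lambda^2V$. For $\eta\in\Lambda^4V^*$, $\hat\eta\colon\Lambda^2V\to\Lambda^2V$ is defined by $g(\hat\eta(x\wedge y),z\wedge w)=\eta(x,y,z,w)$. Inequalities between self-adjoint operators are in the sense of quadratic forms. *)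

theory Defs
  imports "HOL-Analysis.Analysis"
begin

text \<open>\<open>\<Lambda>\<^sup>2V\<close> is identified with the skew-adjoint endomorphisms of \<open>V\<close>.\<close>

typedef (overloaded) 'a so = "{\<Xi> :: 'a::euclidean_space \<Rightarrow> 'a. linear \<Xi> \<and> (\<forall>x y. \<Xi> x \<bullet> y = - (x \<bullet> \<Xi> y))}"
  morphisms so_apply Abs_so
  by (intro exI[of _ "\<lambda>_. 0"]) (auto simp: linear_iff)

setup_lifting type_definition_so

lemma linear_so_apply: "linear (so_apply \<alpha>)"
  using so_apply[of \<alpha>] by simp

lemma skew_so_apply: "so_apply \<alpha> x \<bullet> y = - (x \<bullet> so_apply \<alpha> y)"
  using so_apply[of \<alpha>] by blast

lemma so_eqI: "(\<And>x. so_apply \<alpha> x = so_apply \<beta> x) \<Longrightarrow> \<alpha> = \<beta>"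
  by (metis ext so_apply_inject)

instantiation so :: (euclidean_space) real_vector
begin

lift_definition zero_so :: "'a so" is "\<lambda>_. 0"
  by (auto simp: linear_iff)
lift_definition plus_so :: "'a so \<Rightarrow> 'a so \<Rightarrow> 'a so" is "\<lambda>\<alpha> \<beta> x. \<alpha> x + \<beta> x"
  by (auto simp: linear_iff algebra_simps)
lift_definition minus_so :: "'a so \<Rightarrow> 'a so \<Rightarrow> 'a so" is "\<lambda>\<alpha> \<beta> x. \<alpha> x - \<beta> x"
  by (auto simp: linear_iff algebra_simps)
lift_definition uminus_so :: "'a so \<Rightarrow> 'a so" is "\<lambda>\<alpha> x. - \<alpha> x"
  by (auto simp: linear_iff algebra_simps)
lift_definition scaleR_so :: "real \<Rightarrow> 'a so \<Rightarrow> 'a so" is "\<lambda>c \<alpha> x. c *\<^sub>R \<alpha> x"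
  by (auto simp: linear_iff algebra_simps)

instance
  by standard (transfer; auto simp: algebra_simps)+

end

lemmas so_apply_simps [simp] =
  zero_so.rep_eq plus_so.rep_eq minus_so.rep_eq uminus_so.rep_eq scaleR_so.rep_eq

text \<open>
  In an orthonormal basis \<open>e\<^sub>1, \<dots>, e\<^sub>n\<close> one has
  \<open>\<alpha> = (\<Sum>i<j. (\<alpha> e\<^sub>i \<bullet> e\<^sub>j) e\<^sub>i \<and> e\<^sub>j)\<close>, so the inner product for which the \<open>e\<^sub>i \<and> e\<^sub>j\<close>, \<open>i < j\<close>,
  are orthonormal is \<open>(\<Sum>i<j. (\<alpha> e\<^sub>i \<bullet> e\<^sub>j) (\<beta> e\<^sub>i \<bullet> e\<^sub>j)) = (\<Sum>i. \<alpha> e\<^sub>i \<bullet> \<beta> e\<^sub>i) / 2\<close>; see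
  \<open>inner_so_wedge\<close> and \<open>inner_wedge_wedge\<close> below.
\<close>

instantiation so :: (euclidean_space) real_inner
begin

definition inner_so :: "'a so \<Rightarrow> 'a so \<Rightarrow> real"
  where "inner_so \<alpha> \<beta> = (\<Sum>u\<in>Basis. so_apply \<alpha> u \<bullet> so_apply \<beta> u) / 2"
definition norm_so :: "'a so \<Rightarrow> real"
  where "norm_so \<alpha> = sqrt (inner \<alpha> \<alpha>)"
definition sgn_so :: "'a so \<Rightarrow> 'a so"
  where "sgn_so \<alpha> = \<alpha> /\<^sub>R norm \<alpha>"
definition dist_so :: "'a so \<Rightarrow> 'a so \<Rightarrow> real"
  where "dist_so \<alpha> \<beta> = norm (\<alpha> - \<beta>)"
definition uniformity_so :: "('a so \<times> 'a so) filter"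
  where "uniformity_so = (INF e\<in>{0<..}. principal {(x, y). dist x y < e})"
definition open_so :: "'a so set \<Rightarrow> bool"
  where "open_so U \<longleftrightarrow> (\<forall>x\<in>U. \<forall>\<^sub>F (x', y) in uniformity. x' = x \<longrightarrow> y \<in> U)"

instance
proof
  fix \<alpha> \<beta> \<gamma> :: "'a so" and r :: real
  show "inner \<alpha> \<beta> = inner \<beta> \<alpha>"
    by (simp add: inner_so_def inner_commute)
  show "inner (\<alpha> + \<beta>) \<gamma> = inner \<alpha> \<gamma> + inner \<beta> \<gamma>"
    by (simp add: inner_so_def inner_add_left sum.distrib add_divide_distrib)
  show "inner (r *\<^sub>R \<alpha>) \<beta> = r * inner \<alpha> \<beta>"
    by (simp add: inner_so_def sum_distrib_left)
  show "0 \<le> inner \<alpha> \<alpha>"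
    by (simp add: inner_so_def sum_nonneg)
  show "inner \<alpha> \<alpha> = 0 \<longleftrightarrow> \<alpha> = 0"
  proof
    assume "inner \<alpha> \<alpha> = 0"
    then have "\<forall>u\<in>Basis. so_apply \<alpha> u = 0"
      by (simp add: inner_so_def sum_nonneg_eq_0_iff)
    then have "so_apply \<alpha> = (\<lambda>_. 0)"
      using linear_eq_stdbasis[OF linear_so_apply linear_zero] by blast
    then show "\<alpha> = 0"
      by (intro so_eqI) simp
  qed (simp add: inner_so_def)
qed (simp_all add: norm_so_def sgn_so_def dist_so_def uniformity_so_def open_so_def)

end

lift_definition wedge :: "'a::euclidean_space \<Rightarrow> 'a \<Rightarrow> 'a so" (infixl "\<and>\<^sub>V" 75)
  is "\<lambda>x y z. (x \<bullet> z) *\<^sub>R y - (y \<bullet> z) *\<^sub>R x"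
  by (auto simp: linear_iff algebra_simps inner_commute)

lemma inner_so_wedge: "\<alpha> \<bullet> (x \<and>\<^sub>V y) = so_apply \<alpha> x \<bullet> y"
proof -
  have "(\<Sum>u\<in>Basis. so_apply \<alpha> u \<bullet> ((x \<bullet> u) *\<^sub>R y - (y \<bullet> u) *\<^sub>R x))
      = (\<Sum>u\<in>Basis. (x \<bullet> u) *\<^sub>R so_apply \<alpha> u) \<bullet> y - (\<Sum>u\<in>Basis. (y \<bullet> u) *\<^sub>R so_apply \<alpha> u) \<bullet> x"
    by (simp add: inner_diff_right inner_sum_left sum_subtractf)
  also have "\<dots> = so_apply \<alpha> x \<bullet> y - so_apply \<alpha> y \<bullet> x"
    by (simp flip: linear_sum[OF linear_so_apply] linear_cmul[OF linear_so_apply]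
        add: euclidean_representation)
  also have "so_apply \<alpha> y \<bullet> x = - (so_apply \<alpha> x \<bullet> y)"
    by (subst skew_so_apply) (simp add: inner_commute)
  finally show ?thesis
    by (simp add: inner_so_def wedge.rep_eq)
qed

lemma inner_wedge_wedge:
  "(x \<and>\<^sub>V y) \<bullet> (z \<and>\<^sub>V w) = (x \<bullet> z) * (y \<bullet> w) - (y \<bullet> z) * (x \<bullet> w)"
  by (simp add: inner_so_wedge wedge.rep_eq inner_diff_left)

lemma so_apply_sum: "so_apply (sum f A) x = (\<Sum>a\<in>A. so_apply (f a) x)"
  by (induction A rule: infinite_finite_induct) auto

lemma so_expand: "\<alpha> = (1/2) *\<^sub>R (\<Sum>u\<in>Basis. \<Sum>v\<in>Basis. (\<alpha> \<bullet> (u \<and>\<^sub>V v)) *\<^sub>R (u \<and>\<^sub>V v))"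
proof (rule so_eqI)
  fix z
  have 1: "(\<Sum>v\<in>Basis. (so_apply \<alpha> u \<bullet> v) *\<^sub>R ((u \<bullet> z) *\<^sub>R v - (v \<bullet> z) *\<^sub>R u))
      = (u \<bullet> z) *\<^sub>R so_apply \<alpha> u - (so_apply \<alpha> u \<bullet> z) *\<^sub>R u" for u
  proof -
    have "(\<Sum>v\<in>Basis. (so_apply \<alpha> u \<bullet> v) *\<^sub>R ((u \<bullet> z) *\<^sub>R v - (v \<bullet> z) *\<^sub>R u))
      = (u \<bullet> z) *\<^sub>R (\<Sum>v\<in>Basis. (so_apply \<alpha> u \<bullet> v) *\<^sub>R v) - ((\<Sum>v\<in>Basis. (so_apply \<alpha> u \<bullet> v) *\<^sub>R v) \<bullet> z) *\<^sub>R u"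
      by (simp add: scaleR_diff_right sum_subtractf scaleR_sum_right inner_sum_left scaleR_sum_left mult.commute)
    then show ?thesis by (simp add: euclidean_representation)
  qed
  have 2: "(\<Sum>u\<in>Basis. (u \<bullet> z) *\<^sub>R so_apply \<alpha> u) = so_apply \<alpha> z"
    by (simp flip: linear_sum[OF linear_so_apply] linear_cmul[OF linear_so_apply]
        add: euclidean_representation inner_commute[of _ z])
  have 3: "(\<Sum>u\<in>Basis. (so_apply \<alpha> u \<bullet> z) *\<^sub>R u) = - so_apply \<alpha> z"
  proof -
    have "so_apply \<alpha> u \<bullet> z = - (so_apply \<alpha> z \<bullet> u)" for u
      by (metis skew_so_apply inner_commute)
    then have "(\<Sum>u\<in>Basis. (so_apply \<alpha> u \<bullet> z) *\<^sub>R u) = (\<Sum>u\<in>Basis. - ((so_apply \<alpha> z \<bullet> u) *\<^sub>R u))"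
      by (intro sum.cong) auto
    then show ?thesis by (simp add: sum_negf euclidean_representation)
  qed
  show "so_apply \<alpha> z = so_apply ((1/2) *\<^sub>R (\<Sum>u\<in>Basis. \<Sum>v\<in>Basis. (\<alpha> \<bullet> (u \<and>\<^sub>V v)) *\<^sub>R (u \<and>\<^sub>V v))) z"
    by (simp add: so_apply_sum inner_so_wedge wedge.rep_eq 1 sum_subtractf 2 3
        flip: scaleR_2)
qed

lemma linear_eq_wedge:
  assumes "linear F" "linear G" "\<And>x y. F (x \<and>\<^sub>V y) = G (x \<and>\<^sub>V y)"
  shows "F = G"
proof
  fix \<alpha>
  show "F \<alpha> = G \<alpha>"
    by (subst (1 2) so_expand[of \<alpha>])
      (simp add: linear_cmul[OF assms(1)] linear_cmul[OF assms(2)] linear_sum[OF assms(1)]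
        linear_sum[OF assms(2)] assms(3))
qed

definition qf_le :: "('b::real_inner \<Rightarrow> 'b) \<Rightarrow> ('b \<Rightarrow> 'b) \<Rightarrow> bool" (infix "\<le>\<^sub>q" 50)
  where "S \<le>\<^sub>q T \<longleftrightarrow> (\<forall>\<alpha>. S \<alpha> \<bullet> \<alpha> \<le> T \<alpha> \<bullet> \<alpha>)"

text \<open>
  A \<open>p\<close>-form is a function on lists of vectors, of which only the values on lists of length \<open>p\<close>
  matter; all other values are set to \<open>0\<close>.
\<close>

definition forms :: "nat \<Rightarrow> ('a::euclidean_space list \<Rightarrow> real) set"
  where "forms p = {\<omega>.
    (\<forall>xs. length xs \<noteq> p \<longrightarrow> \<omega> xs = 0) \<and>
    (\<forall>xs i. length xs = p \<longrightarrow> i < p \<longrightarrow> linear (\<lambda>x. \<omega> (xs[i := x]))) \<and>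
    (\<forall>xs i j. length xs = p \<longrightarrow> i < j \<longrightarrow> j < p \<longrightarrow> xs ! i = xs ! j \<longrightarrow> \<omega> xs = 0)}"

text \<open>
  The \<open>e\<^sup>i\<^sup>1 \<and> \<dots> \<and> e\<^sup>i\<^sup>p\<close> with increasing indices are orthonormal, and the coefficient of \<open>\<omega>\<close> at one of
  them is \<open>\<omega>(e\<^sub>i\<^sub>1, \<dots>, e\<^sub>i\<^sub>p)\<close>. Summing over all tuples of basis vectors counts each increasing
  tuple \<open>p!\<close> times.
\<close>

definition form_inner :: "nat \<Rightarrow> ('a::euclidean_space list \<Rightarrow> real) \<Rightarrow> ('a list \<Rightarrow> real) \<Rightarrow> real"
  where "form_inner p \<omega> \<theta> = (\<Sum>xs | set xs \<subseteq> Basis \<and> length xs = p. \<omega> xs * \<theta> xs) / fact p"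

definition form_norm :: "nat \<Rightarrow> ('a::euclidean_space list \<Rightarrow> real) \<Rightarrow> real"
  where "form_norm p \<omega> = sqrt (form_inner p \<omega> \<omega>)"

definition so_act :: "'a::euclidean_space so \<Rightarrow> ('a list \<Rightarrow> real) \<Rightarrow> 'a list \<Rightarrow> real"
  where "so_act \<Xi> \<omega> xs = - (\<Sum>i<length xs. \<omega> (xs[i := so_apply \<Xi> (xs ! i)]))"

text \<open>Existence and uniqueness are \<open>inner_action_op\<close>, \<open>action_op_unique\<close> and
  \<open>inner_hat_op\<close>, \<open>hat_op_unique\<close>.\<close>

definition action_op :: "nat \<Rightarrow> ('a::euclidean_space list \<Rightarrow> real) \<Rightarrow> 'a so \<Rightarrow> 'a so"
  where "action_op p \<omega> = (THE A. linear A \<and>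
    (\<forall>\<alpha> \<beta>. A \<alpha> \<bullet> \<beta> = form_inner p (so_act \<alpha> \<omega>) (so_act \<beta> \<omega>)))"

definition hat_op :: "('a::euclidean_space list \<Rightarrow> real) \<Rightarrow> 'a so \<Rightarrow> 'a so"
  where "hat_op \<eta> = (THE H. linear H \<and>
    (\<forall>x y z w. H (x \<and>\<^sub>V y) \<bullet> (z \<and>\<^sub>V w) = \<eta> [x, y, z, w]))"

lemma action_op_unique:
  assumes "\<And>\<alpha> \<beta>. A \<alpha> \<bullet> \<beta> = form_inner p (so_act \<alpha> \<omega>) (so_act \<beta> \<omega>)"
    and "\<And>\<alpha> \<beta>. B \<alpha> \<bullet> \<beta> = form_inner p (so_act \<alpha> \<omega>) (so_act \<beta> \<omega>)"
  shows "A = B"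
  by (rule ext) (metis assms vector_eq_rdot)

lemma hat_op_unique:
  assumes "linear G" "linear H"
    and "\<And>x y z w. G (x \<and>\<^sub>V y) \<bullet> (z \<and>\<^sub>V w) = \<eta> [x, y, z, w]"
    and "\<And>x y z w. H (x \<and>\<^sub>V y) \<bullet> (z \<and>\<^sub>V w) = \<eta> [x, y, z, w]"
  shows "G = H"
proof (rule linear_eq_wedge[OF assms(1,2)])
  fix x y
  have "(\<lambda>\<beta>. G (x \<and>\<^sub>V y) \<bullet> \<beta>) = (\<lambda>\<beta>. H (x \<and>\<^sub>V y) \<bullet> \<beta>)"
    by (rule linear_eq_wedge) (simp_all add: assms(3,4) linear_iff inner_add_right)
  then show "G (x \<and>\<^sub>V y) = H (x \<and>\<^sub>V y)"
    by (metis vector_eq_rdot)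
qed

lemma so_act_not_length: "\<omega> \<in> forms p \<Longrightarrow> length xs \<noteq> p \<Longrightarrow> so_act \<alpha> \<omega> xs = 0"
  by (simp add: so_act_def forms_def)

lemma linear_so_act:
  assumes "\<omega> \<in> forms p"
  shows "linear (\<lambda>\<alpha>. so_act \<alpha> \<omega> xs)"
proof (cases "length xs = p")
  case True
  have lin: "linear (\<lambda>x. \<omega> (xs[i := x]))" if "i < p" for i
    using assms True that unfolding forms_def by blast
  show ?thesis
    by (rule linearI)
      (simp_all add: so_act_def True linear_add[OF lin] linear_cmul[OF lin]
        sum.distrib sum_distrib_left sum_negf)
next
  case False
  then show ?thesis
    by (simp add: so_act_not_length[OF assms] linear_zero)
qed

lemma action_op_ex:
  assumes "\<omega> \<in> forms p"
  shows "\<exists>A. linear A \<and> (\<forall>\<alpha> \<beta>. A \<alpha> \<bullet> \<beta> = form_inner p (so_act \<alpha> \<omega>) (so_act \<beta> \<omega>))"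
proof -
  define Q where "Q \<alpha> \<beta> = form_inner p (so_act \<alpha> \<omega>) (so_act \<beta> \<omega>)" for \<alpha> \<beta>
  note add = linear_add[OF linear_so_act[OF assms]] and mul = linear_cmul[OF linear_so_act[OF assms]]
  have linl: "linear (\<lambda>\<alpha>. Q \<alpha> \<beta>)" for \<beta>
    by (rule linearI) (simp_all add: Q_def form_inner_def add mul algebra_simps sum.distrib
        sum_distrib_left add_divide_distrib)
  have linr: "linear (Q \<alpha>)" for \<alpha>
    by (rule linearI) (simp_all add: Q_def form_inner_def add mul algebra_simps sum.distrib
        sum_distrib_left add_divide_distrib)
  define A where "A \<alpha> = (1/2) *\<^sub>R (\<Sum>u\<in>Basis. \<Sum>v\<in>Basis. Q \<alpha> (u \<and>\<^sub>V v) *\<^sub>R (u \<and>\<^sub>V v))" for \<alpha>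
  have "linear A"
    by (rule linearI) (simp_all add: A_def linear_add[OF linl] linear_cmul[OF linl]
        scaleR_add_left sum.distrib scaleR_add_right scaleR_sum_right ac_simps)
  moreover have "A \<alpha> \<bullet> \<beta> = Q \<alpha> \<beta>" for \<alpha> \<beta>
  proof -
    have "Q \<alpha> \<beta> = Q \<alpha> ((1/2) *\<^sub>R (\<Sum>u\<in>Basis. \<Sum>v\<in>Basis. (\<beta> \<bullet> (u \<and>\<^sub>V v)) *\<^sub>R (u \<and>\<^sub>V v)))"
      by (subst so_expand[of \<beta>]) (rule refl)
    also have "\<dots> = A \<alpha> \<bullet> \<beta>"
      by (simp add: A_def linear_cmul[OF linr] linear_sum[OF linr] inner_sum_left
          inner_commute[of \<beta>] mult.commute)
    finally show ?thesis by simp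
  qed
  ultimately show ?thesis
    unfolding Q_def by blast
qed

lemma
  assumes "\<omega> \<in> forms p"
  shows linear_action_op: "linear (action_op p \<omega>)"
    and inner_action_op: "action_op p \<omega> \<alpha> \<bullet> \<beta> = form_inner p (so_act \<alpha> \<omega>) (so_act \<beta> \<omega>)"
proof -
  have "linear (action_op p \<omega>) \<and>
      (\<forall>\<alpha> \<beta>. action_op p \<omega> \<alpha> \<bullet> \<beta> = form_inner p (so_act \<alpha> \<omega>) (so_act \<beta> \<omega>))"
    unfolding action_op_def
    by (rule theI'[where P = "\<lambda>A. linear A \<and>
          (\<forall>\<alpha> \<beta>. A \<alpha> \<bullet> \<beta> = form_inner p (so_act \<alpha> \<omega>) (so_act \<beta> \<omega>))"])
      (use action_op_ex[OF assms] action_op_unique[of _ p \<omega>] in blast)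
  then show "linear (action_op p \<omega>)"
    and "action_op p \<omega> \<alpha> \<bullet> \<beta> = form_inner p (so_act \<alpha> \<omega>) (so_act \<beta> \<omega>)"
    by blast+
qed

lemma sum_alternating_bilinear:
  fixes B :: "'a::euclidean_space \<Rightarrow> 'a \<Rightarrow> real"
  assumes l: "\<And>y. linear (\<lambda>x. B x y)" and r: "\<And>x. linear (B x)" and alt: "\<And>x. B x x = 0"
  shows "(\<Sum>u\<in>Basis. \<Sum>v\<in>Basis. ((x \<and>\<^sub>V y) \<bullet> (u \<and>\<^sub>V v)) * B u v) = 2 * B x y"
proof -
  have ex: "(\<Sum>u\<in>Basis. \<Sum>v\<in>Basis. (a \<bullet> u) * (b \<bullet> v) * B u v) = B a b" for a b
  proof -
    have "B a b = B (\<Sum>u\<in>Basis. (a \<bullet> u) *\<^sub>R u) (\<Sum>v\<in>Basis. (b \<bullet> v) *\<^sub>R v)"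
      by (simp add: euclidean_representation)
    also have "\<dots> = (\<Sum>u\<in>Basis. (a \<bullet> u) * B u (\<Sum>v\<in>Basis. (b \<bullet> v) *\<^sub>R v))"
      by (simp only: linear_sum[OF l] linear_cmul[OF l] real_scaleR_def)
    also have "\<dots> = (\<Sum>u\<in>Basis. \<Sum>v\<in>Basis. (a \<bullet> u) * (b \<bullet> v) * B u v)"
      by (simp only: linear_sum[OF r] linear_cmul[OF r] real_scaleR_def sum_distrib_left mult.assoc)
    finally show ?thesis by simp
  qed
  have "B (x + y) (x + y) = B x x + B x y + B y x + B y y"
    by (simp add: linear_add[OF l] linear_add[OF r])
  then have "B y x = - B x y"
    by (simp add: alt)
  moreover have "(\<Sum>u\<in>Basis. \<Sum>v\<in>Basis. ((x \<and>\<^sub>V y) \<bullet> (u \<and>\<^sub>V v)) * B u v) = B x y - B y x"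
    by (simp add: inner_wedge_wedge left_diff_distrib sum_subtractf ex)
  ultimately show ?thesis by simp
qed

lemma hat_op_ex:
  assumes "\<eta> \<in> forms 4"
  shows "\<exists>H. linear H \<and> (\<forall>x y z w. H (x \<and>\<^sub>V y) \<bullet> (z \<and>\<^sub>V w) = \<eta> [x, y, z, w])"
proof -
  have lin: "linear (\<lambda>x. \<eta> (xs[i := x]))" if "length xs = 4" "i < 4" for xs i
    using assms that unfolding forms_def by blast
  have alt: "\<eta> xs = 0" if "length xs = 4" "i < j" "j < 4" "xs ! i = xs ! j" for xs i j
    using assms that unfolding forms_def by blast
  have l0: "linear (\<lambda>x. \<eta> [x, y, z, w])" for y z w using lin[of "[0,y,z,w]" 0] by simp
  have l1: "linear (\<lambda>y. \<eta> [x, y, z, w])" for x z w using lin[of "[x,0,z,w]" 1] by simp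
  have l2: "linear (\<lambda>z. \<eta> [x, y, z, w])" for x y w using lin[of "[x,y,0,w]" 2] by (simp add: numeral_2_eq_2)
  have l3: "linear (\<lambda>w. \<eta> [x, y, z, w])" for x y z using lin[of "[x,y,z,0]" 3] by (simp add: numeral_3_eq_3)
  have a01: "\<eta> [x, x, z, w] = 0" for x z w using alt[of "[x,x,z,w]" 0 1] by simp
  have a23: "\<eta> [x, y, z, z] = 0" for x y z using alt[of "[x,y,z,z]" 2 3] by (simp add: numeral_2_eq_2 numeral_3_eq_3)
  define H where "H \<alpha> = (1/4) *\<^sub>R (\<Sum>u\<in>Basis. \<Sum>v\<in>Basis. (\<alpha> \<bullet> (u \<and>\<^sub>V v)) *\<^sub>R
      (\<Sum>k\<in>Basis. \<Sum>l\<in>Basis. \<eta> [u, v, k, l] *\<^sub>R (k \<and>\<^sub>V l)))" for \<alpha>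
  have "linear H"
  proof (rule linearI)
    show "H (\<alpha> + \<beta>) = H \<alpha> + H \<beta>" for \<alpha> \<beta>
      by (simp only: H_def inner_add_left scaleR_add_left sum.distrib scaleR_add_right)
    show "H (c *\<^sub>R \<alpha>) = c *\<^sub>R H \<alpha>" for c \<alpha>
      by (simp add: H_def scaleR_sum_right ac_simps)
  qed
  moreover have "H (x \<and>\<^sub>V y) \<bullet> (z \<and>\<^sub>V w) = \<eta> [x, y, z, w]" for x y z w
  proof -
    have "(\<Sum>k\<in>Basis. \<Sum>l\<in>Basis. \<eta> [u, v, k, l] *\<^sub>R (k \<and>\<^sub>V l)) \<bullet> (z \<and>\<^sub>V w) = 2 * \<eta> [u, v, z, w]" for u v
      using sum_alternating_bilinear[where B = "\<lambda>k l. \<eta> [u, v, k, l]" and x = z and y = w, OF l2 l3 a23]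
      by (simp add: inner_sum_left inner_commute[of "_ \<and>\<^sub>V _" "z \<and>\<^sub>V w"] mult.commute)
    then have "H (x \<and>\<^sub>V y) \<bullet> (z \<and>\<^sub>V w)
        = (1/2) * (\<Sum>u\<in>Basis. \<Sum>v\<in>Basis. ((x \<and>\<^sub>V y) \<bullet> (u \<and>\<^sub>V v)) * \<eta> [u, v, z, w])"
      by (simp add: H_def inner_sum_left[of "\<lambda>u. \<Sum>v\<in>Basis. _ u v"] inner_sum_left[of "\<lambda>v. _ v *\<^sub>R _ v"]
          sum_distrib_left)
    also have "\<dots> = \<eta> [x, y, z, w]"
      by (subst sum_alternating_bilinear[OF l0 l1 a01]) simp
    finally show ?thesis .
  qed
  ultimately show ?thesis by blast
qed

lemma
  assumes "\<eta> \<in> forms 4"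
  shows linear_hat_op: "linear (hat_op \<eta>)"
    and inner_hat_op: "hat_op \<eta> (x \<and>\<^sub>V y) \<bullet> (z \<and>\<^sub>V w) = \<eta> [x, y, z, w]"
proof -
  have "linear (hat_op \<eta>) \<and> (\<forall>x y z w. hat_op \<eta> (x \<and>\<^sub>V y) \<bullet> (z \<and>\<^sub>V w) = \<eta> [x, y, z, w])"
    unfolding hat_op_def
    by (rule theI'[where P = "\<lambda>H. linear H \<and>
          (\<forall>x y z w. H (x \<and>\<^sub>V y) \<bullet> (z \<and>\<^sub>V w) = \<eta> [x, y, z, w])"])
      (use hat_op_ex[OF assms] hat_op_unique[of _ _ \<eta>] in blast)
  then show "linear (hat_op \<eta>)" and "hat_op \<eta> (x \<and>\<^sub>V y) \<bullet> (z \<and>\<^sub>V w) = \<eta> [x, y, z, w]"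
    by blast+
qed

end

theory Submission
  imports Defs
begin

text \<open>
  Under the half-spin representation \<open>\<Lambda>\<^sup>2V = so(6)\<close> becomes \<open>su(4)\<close> and \<open>\<Lambda>\<^sup>3V\<^sup>*\<close> becomes the space of complex
  symmetric \<open>4 \<times> 4\<close> matrices \<open>S\<close>, both isometrically, where up to sign \<open>a\<close> acts by
  \<open>S \<mapsto> a S + S a\<^sup>T\<close>. The 4-forms correspond to the quadratic forms \<open>2 tr (H a a\<^sup>*)\<close> with
  \<open>H\<close> Hermitian and traceless. By Takagi's factorisation one may assume \<open>S = diag(d\<^sub>1, \<dots>, d\<^sub>4)\<close> with
  \<open>d\<^sub>i \<ge> 0\<close>, and one looks for \<open>H = diag(h\<^sub>1, \<dots>, h\<^sub>4)\<close>. The form \<open>|a S + S a\<^sup>T|\<^sup>2 + 2 tr (H a a\<^sup>*)\<close> then splits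
  into six off-diagonal blocks and a form on the traceless diagonals. The blocks satisfy both bounds as
  soon as \<open>-(d\<^sub>i - d\<^sub>j)\<^sup>2 \<le> h\<^sub>i + h\<^sub>j \<le> (d\<^sub>k - d\<^sub>l)\<^sup>2\<close> whenever \<open>{i,j,k,l} = {1,2,3,4}\<close>. In a Hadamard basis
  the diagonal form is \<open>|S|\<^sup>2\<close> plus a matrix with zero diagonal and off-diagonal entries \<open>P, Q, R\<close>, which
  the block conditions confine to three independent intervals. Taking each entry as close to zero as possible
  makes any two of \<open>|P|, |Q|, |R|\<close> add up to at most \<open>|S|\<^sup>2\<close>, so by Gershgorin's argument the
  diagonal form lies between \<open>0\<close> and \<open>2 |S|\<^sup>2\<close>.
\<close>

section \<open>Complex matrices and Takagi's factorisation\<close>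

lemma matrix_mult_add_left: "(A + B) ** C = A ** C + B ** (C :: 'a::semiring_1^'n^'m)"
  by (simp add: matrix_matrix_mult_def vec_eq_iff distrib_right sum.distrib)

lemma matrix_mult_minus:
  fixes A :: "'a::ring_1^'n^'m" and B :: "'a^'p^'n"
  shows "A ** (- B) = - (A ** B)" "(- A) ** B = - (A ** B)"
  by (simp_all add: matrix_matrix_mult_def vec_eq_iff sum_negf)

lemma matrix_mult_scaleR:
  fixes A :: "'a::real_algebra_1^'n^'m" and B :: "'a^'p^'n"
  shows "A ** (c *\<^sub>R B) = c *\<^sub>R (A ** B)" "(c *\<^sub>R A) ** B = c *\<^sub>R (A ** B)"
  by (simp_all add: matrix_matrix_mult_def vec_eq_iff scaleR_sum_right)

section \<open>Adjoints and the real trace inner product\<close>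

definition adj :: "complex^'n^'m \<Rightarrow> complex^'m^'n"
  where "adj A = (\<chi> i j. cnj (A $ j $ i))"

lemma adj_mul: "adj (A ** B) = adj B ** adj A"
  by (simp add: adj_def matrix_matrix_mult_def vec_eq_iff mult.commute)

lemma adj_adj [simp]: "adj (adj A) = A"
  by (simp add: adj_def vec_eq_iff)

lemma adj_scaleR: "adj (c *\<^sub>R A) = c *\<^sub>R adj A"
  by (simp add: adj_def vec_eq_iff)

lemma adj_transpose: "adj (transpose A) = transpose (adj A)"
  by (simp add: adj_def transpose_def vec_eq_iff)

lemma inner_eq_trace: "A \<bullet> B = Re (trace (A ** adj B))"
  by (simp add: inner_vec_def trace_def matrix_matrix_mult_def adj_def inner_complex_def)

lemma inner_unitary_mult:
  fixes U V A B :: "complex^'n^'n"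
  assumes "adj U ** U = mat 1" "V ** adj V = mat 1"
  shows "(U ** A ** V) \<bullet> (U ** B ** V) = A \<bullet> B"
proof -
  have "U ** A ** V ** adj (U ** B ** V) = U ** (A ** (V ** adj V) ** adj B ** adj U)"
    by (simp add: adj_mul matrix_mul_assoc)
  then have "trace (U ** A ** V ** adj (U ** B ** V)) = trace (A ** adj B ** (adj U ** U))"
    using trace_mul_sym[of U "A ** adj B ** adj U"] by (simp add: assms(2) matrix_mul_assoc)
  then show ?thesis
    by (simp add: inner_eq_trace assms(1))
qed

lemma power2_norm_matrix:
  fixes A :: "complex^'n^'m"
  shows "(norm A)\<^sup>2 = (\<Sum>i\<in>UNIV. \<Sum>j\<in>UNIV. (Re (A $ i $ j))\<^sup>2 + (Im (A $ i $ j))\<^sup>2)"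
  unfolding power2_norm_eq_inner by (simp add: inner_vec_def inner_complex_def power2_eq_square)

section \<open>The Hermitian pairing and the antilinear map of a symmetric matrix\<close>

definition herm :: "complex^'n \<Rightarrow> complex^'n \<Rightarrow> complex"
  where "herm x y = (\<Sum>i\<in>UNIV. cnj (x $ i) * y $ i)"

lemma herm_add: "herm x (y + z) = herm x y + herm x z"
  by (simp add: herm_def algebra_simps sum.distrib)

lemma herm_scaleR: "herm x (c *\<^sub>R y) = of_real c * herm x y"
  by (simp add: herm_def sum_distrib_left) (simp add: algebra_simps scaleR_conv_of_real)

lemma herm_smult: "herm x (c *s y) = c * herm x y"
  by (simp add: herm_def sum_distrib_left mult_ac)

lemma cnj_herm: "cnj (herm x y) = herm y x"
  by (simp add: herm_def mult.commute)

lemma Re_herm: "Re (herm x y) = x \<bullet> y"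
  by (simp add: herm_def inner_vec_def inner_complex_def)

text \<open>Turns complex orthogonality to x into real orthogonality to both x and \<i> x.\<close>

lemma herm_eq_inner: "herm x y = Complex (x \<bullet> y) ((\<i> *s x) \<bullet> y)"
  by (rule complex_eqI)
    (simp_all add: Re_herm, simp add: herm_def inner_vec_def inner_complex_def sum_negf algebra_simps)

lemma herm_self: "herm x x = of_real ((norm x)\<^sup>2)"
  unfolding power2_norm_eq_inner Re_herm[symmetric]
  by (rule complex_eqI) (simp_all, simp add: herm_def algebra_simps)

text \<open>For symmetric \<open>S\<close> this antilinear map is self-adjoint for the real inner
  product. An orthonormal basis of eigenvectors with nonnegative eigenvalues is exactly what
  Takagi's factorisation asks for.\<close>

definition conj_map :: "complex^'n^'n \<Rightarrow> complex^'n \<Rightarrow> complex^'n"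
  where "conj_map S x = (\<chi> i. cnj ((S *v x) $ i))"

lemma conj_map_add: "conj_map S (x + y) = conj_map S x + conj_map S y"
  by (simp add: conj_map_def vec_eq_iff matrix_vector_right_distrib)

lemma conj_map_scaleR: "conj_map S (c *\<^sub>R x) = c *\<^sub>R conj_map S x"
  by (simp add: conj_map_def vec_eq_iff matrix_vector_mult_def sum_distrib_left scaleR_sum_right)

lemma conj_map_smult: "conj_map S (c *s x) = cnj c *s conj_map S x"
  by (simp add: conj_map_def vec_eq_iff matrix_vector_mult_def sum_distrib_left mult_ac)

lemma linear_conj_map: "linear (conj_map S)"
  by (rule linearI) (simp_all add: conj_map_add conj_map_scaleR)

text \<open>Both sides are the complex conjugate of x^T S y.\<close>

lemma herm_conj_map_sym:
  assumes "transpose S = S"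
  shows "herm x (conj_map S y) = herm y (conj_map S x)"
proof -
  have "S $ i $ j = S $ j $ i" for i j
    using assms by (metis transpose_def vec_lambda_beta)
  then have "(\<Sum>i\<in>UNIV. \<Sum>j\<in>UNIV. cnj (x $ i) * (cnj (S $ i $ j) * cnj (y $ j))) =
    (\<Sum>i\<in>UNIV. \<Sum>j\<in>UNIV. cnj (y $ j) * (cnj (S $ j $ i) * cnj (x $ i)))"
    by (intro sum.cong) (auto simp: mult_ac)
  then show ?thesis
    by (subst (asm) (2) sum.swap)
      (simp add: herm_def conj_map_def matrix_vector_mult_def sum_distrib_left)
qed

text \<open>For small t the linear term dominates; t = c / M with M positive and at least K already
  gives a contradiction. It expresses the vanishing of the first variation at a maximum.\<close>

lemma first_order_zero:
  fixes c K :: real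
  assumes "\<And>t. 2 * t * c \<le> t\<^sup>2 * K"
  shows "c = 0"
proof (rule ccontr)
  assume "c \<noteq> 0"
  define M where "M = \<bar>K\<bar> + 1"
  have M: "M > 0" "K \<le> M" unfolding M_def by auto
  have "2 * (c / M) * c \<le> (c / M)\<^sup>2 * K" by (rule assms)
  also have "\<dots> \<le> (c / M)\<^sup>2 * M" using M by (intro mult_left_mono) auto
  also have "\<dots> = c * c / M" using M by (simp add: power2_eq_square field_simps)
  finally have "c * c / M \<le> 0" by simp
  moreover have "c * c / M > 0" using M \<open>c \<noteq> 0\<close>
    by (metis divide_pos_pos not_real_square_gt_zero)
  ultimately show False by simp
qed

text \<open>The next Takagi vector maximises \<open>Re (x\<^sup>T S x)\<close> on the unit sphere of the complex
  orthogonal complement of the previous ones. This complement is invariant under \<open>conj_map S\<close>, and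
  replacing \<open>x\<close> by \<open>\<i> x\<close> flips the sign of the maximised function, so the maximum is nonnegative.\<close>

lemma takagi_step:
  fixes S :: "complex^'n^'n" and v :: "'k \<Rightarrow> complex^'n"
  assumes S: "transpose S = S" and I: "finite I" "card I < CARD('n)"
    and eig: "\<And>i. i \<in> I \<Longrightarrow> conj_map S (v i) = d i *\<^sub>R v i"
  shows "\<exists>x c. 0 \<le> c \<and> herm x x = 1 \<and> (\<forall>i\<in>I. herm (v i) x = 0) \<and> conj_map S x = c *\<^sub>R x"
proof -
  define T where "T = {x. \<forall>i\<in>I. herm (v i) x = 0}"
  have T_add: "x + y \<in> T" if "x \<in> T" "y \<in> T" for x y
    using that by (auto simp: T_def herm_add)
  have T_scaleR: "c *\<^sub>R x \<in> T" if "x \<in> T" for c x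
    using that by (auto simp: T_def herm_scaleR)
  have T_smult: "c *s x \<in> T" if "x \<in> T" for c x
    using that by (auto simp: T_def herm_smult)
  have T_conj_map: "conj_map S x \<in> T" if "x \<in> T" for x
    using that by (auto simp: T_def herm_conj_map_sym[OF S, of _ x] eig herm_scaleR)
      (metis cnj_herm complex_cnj_zero)
  \<comment> \<open>Real orthogonality to the span of \<open>B\<close>, whose real dimension is at
    most 2 \<open>card I\<close> and so below 2n, yields a nonzero vector of
    \<open>T\<close>.\<close>
  define B where "B = v ` I \<union> (\<lambda>i. \<i> *s v i) ` I"
  have "card B \<le> 2 * card I"
    unfolding B_def mult_2
    by (rule order_trans[OF card_Un_le add_mono[OF card_image_le card_image_le]]) (use I in auto)
  moreover have "finite B"
    using I by (auto simp: B_def)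
  ultimately have "dim B < DIM(complex^'n)"
    using dim_le_card'[of B] I by simp
  then obtain x0 where x0: "x0 \<noteq> 0" "\<And>y. y \<in> span B \<Longrightarrow> orthogonal x0 y"
    using orthogonal_to_subspace_exists by blast
  have "x0 \<in> T"
    using x0(2)[OF span_base]
    by (auto simp: T_def herm_eq_inner B_def orthogonal_def inner_commute[of x0] complex_eq_iff)
  then have ne: "T \<inter> sphere 0 1 \<noteq> {}"
    using x0(1) T_scaleR[of x0 "1 / norm x0"] by (auto intro!: exI[of _ "(1 / norm x0) *\<^sub>R x0"])
  have "closed T"
  proof -
    have "T = (\<Inter>i\<in>I. {x. herm (v i) x = 0})" by (auto simp: T_def)
    moreover have "closed {x. herm (v i) x = 0}" for i
      by (intro closed_Collect_eq) (auto simp: herm_def intro!: continuous_intros)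
    ultimately show ?thesis by (auto intro: closed_INT)
  qed
  then have comp: "compact (T \<inter> sphere 0 1)"
    by (simp add: closed_Int_compact)
  have cont: "continuous_on (T \<inter> sphere 0 1) (\<lambda>x. x \<bullet> conj_map S x)"
    by (intro continuous_intros linear_continuous_on)
      (simp add: linear_conj_map linear_conv_bounded_linear[symmetric])
  obtain x where x: "x \<in> T" "norm x = 1"
    and max: "\<And>y. y \<in> T \<Longrightarrow> norm y = 1 \<Longrightarrow> y \<bullet> conj_map S y \<le> x \<bullet> conj_map S x"
    using continuous_attains_sup[OF comp ne cont] by auto
  define c where "c = x \<bullet> conj_map S x"
  have max': "y \<bullet> conj_map S y \<le> c * (norm y)\<^sup>2" if "y \<in> T" for y
  proof (cases "y = 0")
    case False
    have "((1 / norm y) *\<^sub>R y) \<bullet> conj_map S ((1 / norm y) *\<^sub>R y) \<le> c"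
      unfolding c_def using False that by (intro max T_scaleR) auto
    then show ?thesis
      using False by (simp add: conj_map_scaleR field_simps power2_eq_square)
  qed (simp add: linear_0[OF linear_conj_map])
  \<comment> \<open>Half the gradient at x of the quotient of y \<bullet>
    \<open>conj_map S y\<close> by the squared norm. Moving from x along \<open>g\<close> stays in
    \<open>T\<close>, so maximality forces \<open>g\<close> to vanish.\<close>
  define g where "g = conj_map S x - c *\<^sub>R x"
  have "g \<in> T"
    using T_add[OF T_conj_map[OF x(1)] T_scaleR[OF x(1), of "- c"]] by (simp add: g_def)
  have "2 * t * (g \<bullet> g) \<le> t\<^sup>2 * (c * (g \<bullet> g) - g \<bullet> conj_map S g)" for t
  proof -
    have sym: "g \<bullet> conj_map S x = x \<bullet> conj_map S g"
      by (metis Re_herm herm_conj_map_sym[OF S])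
    have "(x + t *\<^sub>R g) \<bullet> conj_map S (x + t *\<^sub>R g) \<le> c * (norm (x + t *\<^sub>R g))\<^sup>2"
      by (intro max' T_add T_scaleR x \<open>g \<in> T\<close>)
    moreover have "(x + t *\<^sub>R g) \<bullet> conj_map S (x + t *\<^sub>R g) = c + 2 * t * (g \<bullet> conj_map S x) + t\<^sup>2 * (g \<bullet> conj_map S g)"
      by (simp add: conj_map_add conj_map_scaleR c_def inner_add_left inner_add_right sym power2_eq_square algebra_simps)
    moreover have "(norm (x + t *\<^sub>R g))\<^sup>2 = 1 + 2 * t * (g \<bullet> x) + t\<^sup>2 * (g \<bullet> g)"
      unfolding power2_norm_eq_inner
      using x(2) by (simp add: norm_eq_1 inner_add_left inner_add_right inner_commute[of x g]
          power2_eq_square algebra_simps)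
    moreover have "g \<bullet> conj_map S x = g \<bullet> g + c * (g \<bullet> x)"
      by (simp add: g_def inner_diff_left inner_diff_right algebra_simps)
    ultimately have "c + 2 * t * (g \<bullet> g + c * (g \<bullet> x)) + t\<^sup>2 * (g \<bullet> conj_map S g) \<le> c * (1 + 2 * t * (g \<bullet> x) + t\<^sup>2 * (g \<bullet> g))"
      by (simp only:)
    then show ?thesis
      by (simp add: algebra_simps)
  qed
  then have "g \<bullet> g = 0"
    by (rule first_order_zero)
  then have "g = 0" by simp
  have "0 \<le> c"
  proof -
    have "norm (\<i> *s x) = 1"
      using x(2) by (simp add: norm_vec_def norm_mult)
    then have "(\<i> *s x) \<bullet> conj_map S (\<i> *s x) \<le> c"
      unfolding c_def by (intro max T_smult x)
    moreover have "(\<i> *s x) \<bullet> conj_map S (\<i> *s x) = - c"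
      by (simp add: conj_map_smult c_def inner_vec_def inner_complex_def sum_negf[symmetric] algebra_simps)
    ultimately show ?thesis by simp
  qed
  moreover have "herm x x = 1"
    using x(2) by (simp add: herm_self)
  ultimately show ?thesis
    using x(1) \<open>g = 0\<close> by (auto simp: T_def g_def)
qed

text \<open>Induction over subsets of the index type: \<open>takagi_step\<close> supplies one
  further vector as long as the subset is proper.\<close>

lemma takagi_vectors:
  fixes S :: "complex^'n^'n"
  assumes S: "transpose S = S"
  shows "\<exists>v d. (\<forall>i::'n. 0 \<le> d i \<and> conj_map S (v i) = d i *\<^sub>R v i) \<and>
    (\<forall>i j. herm (v i) (v j) = (if i = j then 1 else 0))"
proof -
  have "\<exists>v d. (\<forall>i\<in>I. 0 \<le> d i \<and> conj_map S (v i) = d i *\<^sub>R v i) \<and>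
    (\<forall>i\<in>I. \<forall>j\<in>I. herm (v i) (v j) = (if i = j then 1 else 0))" for I :: "'n set"
  proof (induction I rule: finite_induct[OF finite])
    case (2 k I)
    then obtain v d where IH: "\<forall>i\<in>I. 0 \<le> d i \<and> conj_map S (v i) = d i *\<^sub>R v i"
      "\<forall>i\<in>I. \<forall>j\<in>I. herm (v i) (v j) = (if i = j then 1 else 0)" by blast
    have "card I < CARD('n)"
      using 2 by (metis UNIV_I finite psubset_card_mono psubsetI subset_UNIV)
    then obtain x c where x: "0 \<le> c" "herm x x = 1" "\<forall>i\<in>I. herm (v i) x = 0" "conj_map S x = c *\<^sub>R x"
      using takagi_step[OF S, of I v d] IH 2(1) by blast
    have "\<forall>i\<in>I. herm x (v i) = 0"
      using x(3) by (metis cnj_herm complex_cnj_zero)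
    then show ?case
      using x IH 2(2) by (intro exI[of _ "v(k := x)"] exI[of _ "d(k := c)"]) auto
  qed simp
  from this[of UNIV] show ?thesis by simp
qed

definition diag :: "('n \<Rightarrow> real) \<Rightarrow> complex^'n^'n"
  where "diag d = (\<chi> i j. if i = j then of_real (d i) else 0)"

text \<open>The columns of U are the Takagi vectors, and each entry of U^T S U is the conjugate of
  \<open>herm (v i) (conj_map S (v j))\<close>.\<close>

lemma takagi:
  fixes S :: "complex^'n^'n"
  assumes S: "transpose S = S"
  obtains U :: "complex^'n^'n" and d where "adj U ** U = mat 1" "\<And>i. 0 \<le> d i"
    "transpose U ** S ** U = diag d"
proof -
  obtain v d where vd: "\<And>i::'n. 0 \<le> d i" "\<And>i. conj_map S (v i) = d i *\<^sub>R v i"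
    "\<And>i j. herm (v i) (v j) = (if i = j then 1 else 0)"
    using takagi_vectors[OF S] by metis
  define U where "U = (\<chi> i j. v j $ i)"
  have 1: "adj U ** U = mat 1"
    using vd(3) by (simp add: vec_eq_iff U_def adj_def matrix_matrix_mult_def herm_def mat_def)
  have 2: "(transpose U ** (S ** U)) $ i $ j = (if i = j then of_real (d i) else 0)" for i j
  proof -
    have "cnj ((transpose U ** (S ** U)) $ i $ j) = herm (v i) (conj_map S (v j))"
      by (simp add: U_def transpose_def matrix_matrix_mult_def herm_def conj_map_def matrix_vector_mult_def)
    also have "\<dots> = (if i = j then of_real (d i) else 0)"
      by (simp add: vd herm_scaleR)
    finally have "cnj (cnj ((transpose U ** (S ** U)) $ i $ j)) = cnj (if i = j then of_real (d i) else 0)"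
      by simp
    then show ?thesis by (simp split: if_splits)
  qed
  show thesis
    by (rule that[OF 1, of d]) (simp_all add: diag_def vd(1) vec_eq_iff 2 matrix_mul_assoc[symmetric])
qed

section \<open>Choice of the weights\<close>

lemma closest_to_zero:
  fixes l u :: real
  assumes "l \<le> u"
  obtains P where "l \<le> P" "P \<le> u" "\<bar>P\<bar> \<le> max 0 (max l (- u))"
  \<comment> \<open>The witness is the point of the interval from l to u nearest to 0.\<close>
  using assms by (intro that[of "max l (min 0 u)"]) auto

lemma two_products_bound:
  fixes a b c e :: real
  shows "(2*a*b - c\<^sup>2 - e\<^sup>2) + (2*a*c - b\<^sup>2 - e\<^sup>2) \<le> a\<^sup>2 + b\<^sup>2 + c\<^sup>2 + e\<^sup>2"
proof -
  \<comment> \<open>This sum of squares is twice the difference of the two sides.\<close>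
  have "0 \<le> (a - 2*b)\<^sup>2 + (a - 2*c)\<^sup>2 + 6 * e\<^sup>2" by simp
  then show ?thesis by (simp add: power2_eq_square algebra_simps)
qed

lemma product_bound:
  fixes a b c e :: real
  shows "2*a*b - c\<^sup>2 - e\<^sup>2 \<le> a\<^sup>2 + b\<^sup>2 + c\<^sup>2 + e\<^sup>2"
proof -
  have "0 \<le> (a - b)\<^sup>2 + 2 * c\<^sup>2 + 2 * e\<^sup>2" by simp
  then show ?thesis by (simp add: power2_eq_square algebra_simps)
qed

text \<open>A product occurring in the bound for P and one occurring in the bound for Q share
  exactly one variable, so \<open>two_products_bound\<close> applies after relabelling. If one of
  the maxima is 0, \<open>product_bound\<close> suffices.\<close>

lemma pairing_bound:
  fixes a b c e P Q :: real
  assumes P: "\<bar>P\<bar> \<le> max 0 (max (2*a*b - c\<^sup>2 - e\<^sup>2) (2*c*e - a\<^sup>2 - b\<^sup>2))"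
    and Q: "\<bar>Q\<bar> \<le> max 0 (max (2*a*c - b\<^sup>2 - e\<^sup>2) (2*b*e - a\<^sup>2 - c\<^sup>2))"
  shows "\<bar>P\<bar> + \<bar>Q\<bar> \<le> a\<^sup>2 + b\<^sup>2 + c\<^sup>2 + e\<^sup>2"
proof -
  have "0 \<le> a\<^sup>2 + b\<^sup>2 + c\<^sup>2 + e\<^sup>2" by simp
  with P Q two_products_bound[of a b c e] two_products_bound[of b a e c]
    two_products_bound[of c e a b] two_products_bound[of e c b a]
    product_bound[of a b c e] product_bound[of c e a b] product_bound[of a c b e] product_bound[of b e a c]
  show ?thesis
    unfolding max_def by (auto split: if_splits simp: algebra_simps)
qed

text \<open>The coefficients are (b - a)^2 + h and (b + a)^2 + h, the first being the smaller. The
  lower bound on h makes it nonnegative; the upper bound follows since (a + b)^2 + (c - e)^2 is 2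
  (a^2 + b^2 + c^2 + e^2) minus two squares.\<close>

lemma off_diag_bounds:
  fixes a b c e h x y :: real
  assumes "0 \<le> a" "0 \<le> b" "- (a - b)\<^sup>2 \<le> h" "h \<le> (c - e)\<^sup>2"
  shows "0 \<le> (b - a)\<^sup>2 * x\<^sup>2 + (b + a)\<^sup>2 * y\<^sup>2 + h * (x\<^sup>2 + y\<^sup>2)" (is ?A)
    and "(b - a)\<^sup>2 * x\<^sup>2 + (b + a)\<^sup>2 * y\<^sup>2 + h * (x\<^sup>2 + y\<^sup>2) \<le> 2 * (a\<^sup>2 + b\<^sup>2 + c\<^sup>2 + e\<^sup>2) * (x\<^sup>2 + y\<^sup>2)" (is ?B)
proof -
  have ab: "0 \<le> a * b" using assms by simp
  have sq: "0 \<le> (a - b)\<^sup>2" "0 \<le> (c + e)\<^sup>2" by simp_all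
  have "0 \<le> (b - a)\<^sup>2 + h" using assms(3) by (simp add: power2_commute)
  moreover have "0 \<le> (b + a)\<^sup>2 + h" using assms(3) ab by (simp add: power2_eq_square algebra_simps)
  ultimately have "0 \<le> ((b - a)\<^sup>2 + h) * x\<^sup>2 + ((b + a)\<^sup>2 + h) * y\<^sup>2" by simp
  then show ?A by (simp add: algebra_simps)
  have "(b + a)\<^sup>2 + h \<le> 2 * (a\<^sup>2 + b\<^sup>2 + c\<^sup>2 + e\<^sup>2)"
    using assms(4) sq by (simp add: power2_eq_square algebra_simps)
  moreover have "(b - a)\<^sup>2 + h \<le> (b + a)\<^sup>2 + h" using ab by (simp add: power2_eq_square algebra_simps)
  ultimately have "((b - a)\<^sup>2 + h) * x\<^sup>2 + ((b + a)\<^sup>2 + h) * y\<^sup>2 \<le> 2 * (a\<^sup>2 + b\<^sup>2 + c\<^sup>2 + e\<^sup>2) * x\<^sup>2 + 2 * (a\<^sup>2 + b\<^sup>2 + c\<^sup>2 + e\<^sup>2) * y\<^sup>2"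
    by (intro add_mono mult_right_mono) auto
  then show ?B by (simp add: algebra_simps)
qed

text \<open>Gershgorin's argument: each mixed term is split by 2 |yz| \<le> y^2 + z^2, and the
  coefficients collected at each square are the absolute row sums.\<close>

lemma ternary_form_bound:
  fixes P Q R s u v w :: real
  assumes "\<bar>R\<bar> + \<bar>Q\<bar> \<le> s" "\<bar>R\<bar> + \<bar>P\<bar> \<le> s" "\<bar>Q\<bar> + \<bar>P\<bar> \<le> s"
  shows "\<bar>2 * (R * u * v + Q * u * w + P * v * w)\<bar> \<le> s * (u\<^sup>2 + v\<^sup>2 + w\<^sup>2)"
proof -
  have *: "2 * \<bar>X*y*z\<bar> \<le> \<bar>X\<bar> * (y\<^sup>2 + z\<^sup>2)" for X y z :: real
  proof -
    have "2 * \<bar>y * z\<bar> \<le> y\<^sup>2 + z\<^sup>2"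
      using sum_squares_bound[of "\<bar>y\<bar>" "\<bar>z\<bar>"] by (simp add: abs_mult)
    then have "\<bar>X\<bar> * (2 * \<bar>y * z\<bar>) \<le> \<bar>X\<bar> * (y\<^sup>2 + z\<^sup>2)"
      by (intro mult_left_mono) auto
    then show ?thesis by (simp add: abs_mult mult_ac)
  qed
  have "\<bar>2 * (R * u * v + Q * u * w + P * v * w)\<bar> \<le> 2 * \<bar>R * u * v\<bar> + 2 * \<bar>Q * u * w\<bar> + 2 * \<bar>P * v * w\<bar>"
    using abs_triangle_ineq[of "R * u * v + Q * u * w" "P * v * w"] abs_triangle_ineq[of "R * u * v" "Q * u * w"]
    by (simp only: abs_mult[of 2] abs_numeral distrib_left[symmetric]) simp
  also have "\<dots> \<le> \<bar>R\<bar> * (u\<^sup>2 + v\<^sup>2) + \<bar>Q\<bar> * (u\<^sup>2 + w\<^sup>2) + \<bar>P\<bar> * (v\<^sup>2 + w\<^sup>2)"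
    by (intro add_mono *)
  also have "\<dots> = (\<bar>R\<bar> + \<bar>Q\<bar>) * u\<^sup>2 + (\<bar>R\<bar> + \<bar>P\<bar>) * v\<^sup>2 + (\<bar>Q\<bar> + \<bar>P\<bar>) * w\<^sup>2"
    by (simp add: algebra_simps)
  also have "\<dots> \<le> s * u\<^sup>2 + s * v\<^sup>2 + s * w\<^sup>2"
    by (intro add_mono mult_right_mono assms) auto
  finally show ?thesis by (simp add: algebra_simps)
qed

text \<open>In the orthonormal basis \<open>(1,1,-1,-1)/2\<close>, \<open>(1,-1,1,-1)/2\<close>, \<open>(1,-1,-1,1)/2\<close> of the traceless
  diagonals the matrix of the quadratic form has constant diagonal \<open>a\<^sup>2 + b\<^sup>2 + c\<^sup>2 + e\<^sup>2\<close> and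
  off-diagonal entries \<open>P, Q, R\<close>.\<close>

lemma diagonal_form:
  fixes y1 y2 y3 y4 :: real
  assumes "y1 + y2 + y3 + y4 = 0"
    and h: "h1 = (p + q + r) / 2" "h2 = (p - q - r) / 2" "h3 = (q - p - r) / 2" "h4 = (r - p - q) / 2"
    and PQR: "P = a\<^sup>2 + b\<^sup>2 - c\<^sup>2 - e\<^sup>2 + p" "Q = a\<^sup>2 + c\<^sup>2 - b\<^sup>2 - e\<^sup>2 + q" "R = a\<^sup>2 + e\<^sup>2 - b\<^sup>2 - c\<^sup>2 + r"
    and bounds: "\<bar>P\<bar> + \<bar>Q\<bar> \<le> s" "\<bar>P\<bar> + \<bar>R\<bar> \<le> s" "\<bar>Q\<bar> + \<bar>R\<bar> \<le> s"
    and s: "s = a\<^sup>2 + b\<^sup>2 + c\<^sup>2 + e\<^sup>2"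
  shows "0 \<le> (4*a\<^sup>2 + 2*h1) * y1\<^sup>2 + (4*b\<^sup>2 + 2*h2) * y2\<^sup>2 + (4*c\<^sup>2 + 2*h3) * y3\<^sup>2 + (4*e\<^sup>2 + 2*h4) * y4\<^sup>2"
    and "(4*a\<^sup>2 + 2*h1) * y1\<^sup>2 + (4*b\<^sup>2 + 2*h2) * y2\<^sup>2 + (4*c\<^sup>2 + 2*h3) * y3\<^sup>2 + (4*e\<^sup>2 + 2*h4) * y4\<^sup>2
      \<le> 2 * s * (y1\<^sup>2 + y2\<^sup>2 + y3\<^sup>2 + y4\<^sup>2)"
proof -
  \<comment> \<open>The coordinates of y in the Hadamard basis; for instance (y1 + y2 - y3 - y4) / 2
    equals y1 + y2 because the trace vanishes.\<close>
  define u v w where uvw: "u = y1 + y2" "v = y1 + y3" "w = y1 + y4"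
  have y: "y1 = (u + v + w) / 2" "y2 = (u - v - w) / 2" "y3 = (v - u - w) / 2" "y4 = (w - u - v) / 2"
    using assms(1) unfolding uvw by simp_all
  have 1: "(4*a\<^sup>2 + 2*h1) * y1\<^sup>2 + (4*b\<^sup>2 + 2*h2) * y2\<^sup>2 + (4*c\<^sup>2 + 2*h3) * y3\<^sup>2 + (4*e\<^sup>2 + 2*h4) * y4\<^sup>2
    = s * (u\<^sup>2 + v\<^sup>2 + w\<^sup>2) + 2 * (R * u * v + Q * u * w + P * v * w)"
    unfolding h y PQR s by (simp add: power2_eq_square field_simps)
  have 2: "y1\<^sup>2 + y2\<^sup>2 + y3\<^sup>2 + y4\<^sup>2 = u\<^sup>2 + v\<^sup>2 + w\<^sup>2"
    unfolding y by (simp add: power2_eq_square field_simps)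
  have 3: "\<bar>2 * (R * u * v + Q * u * w + P * v * w)\<bar> \<le> s * (u\<^sup>2 + v\<^sup>2 + w\<^sup>2)"
    using bounds by (intro ternary_form_bound) auto
  show "0 \<le> (4*a\<^sup>2 + 2*h1) * y1\<^sup>2 + (4*b\<^sup>2 + 2*h2) * y2\<^sup>2 + (4*c\<^sup>2 + 2*h3) * y3\<^sup>2 + (4*e\<^sup>2 + 2*h4) * y4\<^sup>2"
    using 3 unfolding 1 by linarith
  show "(4*a\<^sup>2 + 2*h1) * y1\<^sup>2 + (4*b\<^sup>2 + 2*h2) * y2\<^sup>2 + (4*c\<^sup>2 + 2*h3) * y3\<^sup>2 + (4*e\<^sup>2 + 2*h4) * y4\<^sup>2
      \<le> 2 * s * (y1\<^sup>2 + y2\<^sup>2 + y3\<^sup>2 + y4\<^sup>2)"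
    using 3 unfolding 1 2 by linarith
qed

text \<open>In terms of P the constraints on p read 2ab - c^2 - e^2 \<le> P \<le> a^2 + b^2 - 2ce,
  an interval of length (a - b)^2 + (c - e)^2. Q and R arise by permuting variables, so all three
  can be taken nearest to 0 independently, and \<open>pairing_bound\<close> applies to each
  pair.\<close>

lemma weights_exist:
  fixes a b c e :: real
  assumes "0 \<le> a" "0 \<le> b" "0 \<le> c" "0 \<le> e"
  obtains p q r P Q R where
    "- (a - b)\<^sup>2 \<le> p" "p \<le> (c - e)\<^sup>2" "- (a - c)\<^sup>2 \<le> q" "q \<le> (b - e)\<^sup>2" "- (a - e)\<^sup>2 \<le> r" "r \<le> (b - c)\<^sup>2"
    "P = a\<^sup>2 + b\<^sup>2 - c\<^sup>2 - e\<^sup>2 + p" "Q = a\<^sup>2 + c\<^sup>2 - b\<^sup>2 - e\<^sup>2 + q" "R = a\<^sup>2 + e\<^sup>2 - b\<^sup>2 - c\<^sup>2 + r"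
    "\<bar>P\<bar> + \<bar>Q\<bar> \<le> a\<^sup>2 + b\<^sup>2 + c\<^sup>2 + e\<^sup>2" "\<bar>P\<bar> + \<bar>R\<bar> \<le> a\<^sup>2 + b\<^sup>2 + c\<^sup>2 + e\<^sup>2" "\<bar>Q\<bar> + \<bar>R\<bar> \<le> a\<^sup>2 + b\<^sup>2 + c\<^sup>2 + e\<^sup>2"
proof -
  have ex: "\<exists>P. 2*x*y - z\<^sup>2 - w\<^sup>2 \<le> P \<and> P \<le> x\<^sup>2 + y\<^sup>2 - 2*z*w \<and>
      \<bar>P\<bar> \<le> max 0 (max (2*x*y - z\<^sup>2 - w\<^sup>2) (2*z*w - x\<^sup>2 - y\<^sup>2))" for x y z w :: real
  proof -
    have "0 \<le> (x - y)\<^sup>2 + (z - w)\<^sup>2" by simp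
    then have "2*x*y - z\<^sup>2 - w\<^sup>2 \<le> x\<^sup>2 + y\<^sup>2 - 2*z*w" by (simp add: power2_eq_square algebra_simps)
    from closest_to_zero[OF this] obtain P where "2*x*y - z\<^sup>2 - w\<^sup>2 \<le> P" "P \<le> x\<^sup>2 + y\<^sup>2 - 2*z*w"
      "\<bar>P\<bar> \<le> max 0 (max (2*x*y - z\<^sup>2 - w\<^sup>2) (- (x\<^sup>2 + y\<^sup>2 - 2*z*w)))" .
    moreover have "- (x\<^sup>2 + y\<^sup>2 - 2*z*w) = 2*z*w - x\<^sup>2 - y\<^sup>2" by simp
    ultimately show ?thesis by metis
  qed
  obtain P where P: "2*a*b - c\<^sup>2 - e\<^sup>2 \<le> P" "P \<le> a\<^sup>2 + b\<^sup>2 - 2*c*e"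
    "\<bar>P\<bar> \<le> max 0 (max (2*a*b - c\<^sup>2 - e\<^sup>2) (2*c*e - a\<^sup>2 - b\<^sup>2))" using ex by blast
  obtain Q where Q: "2*a*c - b\<^sup>2 - e\<^sup>2 \<le> Q" "Q \<le> a\<^sup>2 + c\<^sup>2 - 2*b*e"
    "\<bar>Q\<bar> \<le> max 0 (max (2*a*c - b\<^sup>2 - e\<^sup>2) (2*b*e - a\<^sup>2 - c\<^sup>2))" using ex by blast
  obtain R where R: "2*a*e - b\<^sup>2 - c\<^sup>2 \<le> R" "R \<le> a\<^sup>2 + e\<^sup>2 - 2*b*c"
    "\<bar>R\<bar> \<le> max 0 (max (2*a*e - b\<^sup>2 - c\<^sup>2) (2*b*c - a\<^sup>2 - e\<^sup>2))" using ex by blast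
  show thesis
  proof (rule that)
    show "\<bar>P\<bar> + \<bar>Q\<bar> \<le> a\<^sup>2 + b\<^sup>2 + c\<^sup>2 + e\<^sup>2"
      by (rule pairing_bound[OF P(3) Q(3)])
    have "\<bar>P\<bar> + \<bar>R\<bar> \<le> a\<^sup>2 + b\<^sup>2 + e\<^sup>2 + c\<^sup>2"
      by (rule pairing_bound) (use P(3) R(3) in \<open>simp_all add: algebra_simps\<close>)
    then show "\<bar>P\<bar> + \<bar>R\<bar> \<le> a\<^sup>2 + b\<^sup>2 + c\<^sup>2 + e\<^sup>2" by simp
    have "\<bar>Q\<bar> + \<bar>R\<bar> \<le> a\<^sup>2 + c\<^sup>2 + e\<^sup>2 + b\<^sup>2"
      by (rule pairing_bound) (use Q(3) R(3) in \<open>simp_all add: algebra_simps\<close>)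
    then show "\<bar>Q\<bar> + \<bar>R\<bar> \<le> a\<^sup>2 + b\<^sup>2 + c\<^sup>2 + e\<^sup>2" by simp
    show "P = a\<^sup>2 + b\<^sup>2 - c\<^sup>2 - e\<^sup>2 + (P - (a\<^sup>2 + b\<^sup>2 - c\<^sup>2 - e\<^sup>2))"
      "Q = a\<^sup>2 + c\<^sup>2 - b\<^sup>2 - e\<^sup>2 + (Q - (a\<^sup>2 + c\<^sup>2 - b\<^sup>2 - e\<^sup>2))"
      "R = a\<^sup>2 + e\<^sup>2 - b\<^sup>2 - c\<^sup>2 + (R - (a\<^sup>2 + e\<^sup>2 - b\<^sup>2 - c\<^sup>2))"
      by simp_all
  qed (use P(1,2) Q(1,2) R(1,2) in \<open>simp_all add: power2_diff\<close>)
qed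

section \<open>Diagonal and symmetric matrices\<close>

lemma mult_diag_nth: "(A ** diag d) $ i $ j = A $ i $ j * of_real (d j)"
proof -
  have "(A ** diag d) $ i $ j = (\<Sum>k\<in>UNIV. if k = j then A $ i $ k * of_real (d k) else 0)"
    unfolding matrix_matrix_mult_def diag_def vec_lambda_beta by (intro sum.cong) auto
  then show ?thesis by simp
qed

lemma diag_mult_nth: "(diag d ** A) $ i $ j = of_real (d i) * A $ i $ j"
proof -
  have "(diag d ** A) $ i $ j = (\<Sum>k\<in>UNIV. if k = i then of_real (d i) * A $ k $ j else 0)"
    unfolding matrix_matrix_mult_def diag_def vec_lambda_beta by (intro sum.cong) auto
  then show ?thesis by simp
qed

lemma diagonal_matrix_form_bounds:
  fixes d :: "4 \<Rightarrow> real"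
  assumes d: "\<And>i. 0 \<le> d i"
  shows "\<exists>h :: 4 \<Rightarrow> real. sum h UNIV = 0 \<and> (\<forall>b. adj b = - b \<longrightarrow> trace b = 0 \<longrightarrow>
      (norm (b ** diag d + diag d ** transpose b))\<^sup>2 + 2 * (\<Sum>i\<in>UNIV. h i * (norm (b $ i))\<^sup>2)
        \<in> {0..2 * (norm (diag d))\<^sup>2 * (norm b)\<^sup>2})"
proof -
  obtain p q r P Q R where pqr: "- (d 1 - d 2)\<^sup>2 \<le> p" "p \<le> (d 3 - d 4)\<^sup>2"
      "- (d 1 - d 3)\<^sup>2 \<le> q" "q \<le> (d 2 - d 4)\<^sup>2" "- (d 1 - d 4)\<^sup>2 \<le> r" "r \<le> (d 2 - d 3)\<^sup>2"
    and PQR: "P = (d 1)\<^sup>2 + (d 2)\<^sup>2 - (d 3)\<^sup>2 - (d 4)\<^sup>2 + p"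
      "Q = (d 1)\<^sup>2 + (d 3)\<^sup>2 - (d 2)\<^sup>2 - (d 4)\<^sup>2 + q" "R = (d 1)\<^sup>2 + (d 4)\<^sup>2 - (d 2)\<^sup>2 - (d 3)\<^sup>2 + r"
    and bounds: "\<bar>P\<bar> + \<bar>Q\<bar> \<le> (d 1)\<^sup>2 + (d 2)\<^sup>2 + (d 3)\<^sup>2 + (d 4)\<^sup>2"
      "\<bar>P\<bar> + \<bar>R\<bar> \<le> (d 1)\<^sup>2 + (d 2)\<^sup>2 + (d 3)\<^sup>2 + (d 4)\<^sup>2"
      "\<bar>Q\<bar> + \<bar>R\<bar> \<le> (d 1)\<^sup>2 + (d 2)\<^sup>2 + (d 3)\<^sup>2 + (d 4)\<^sup>2"
    using weights_exist[OF d[of 1] d[of 2] d[of 3] d[of 4]] by metis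
  define s where "s = (d 1)\<^sup>2 + (d 2)\<^sup>2 + (d 3)\<^sup>2 + (d 4)\<^sup>2"
  \<comment> \<open>The solution of h1 + h2 = p, h1 + h3 = q, h1 + h4 = r with total sum 0.
    Complementary pairs have opposite sums, so the constraints on p, q, r cover all six
    blocks.\<close>
  define h1 where "h1 = (p + q + r) / 2"
  define h2 where "h2 = (p - q - r) / 2"
  define h3 where "h3 = (q - p - r) / 2"
  define h4 where "h4 = (r - p - q) / 2"
  note h_defs = h1_def h2_def h3_def h4_def
  have h_sums: "h1 + h2 = p" "h1 + h3 = q" "h1 + h4 = r" "h2 + h3 = - r" "h2 + h4 = - q" "h3 + h4 = - p"
    by (simp_all add: h_defs field_simps)
  define h :: "4 \<Rightarrow> real" where "h i = (if i = 1 then h1 else if i = 2 then h2 else if i = 3 then h3 else h4)" for i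
  have h [simp]: "h 1 = h1" "h 2 = h2" "h 3 = h3" "h 4 = h4"
    by (simp_all add: h_def)
  have "(norm (b ** diag d + diag d ** transpose b))\<^sup>2 + 2 * (\<Sum>i\<in>UNIV. h i * (norm (b $ i))\<^sup>2)
        \<in> {0..2 * (norm (diag d))\<^sup>2 * (norm b)\<^sup>2}"
    if skew: "adj b = - b" and tr: "trace b = 0" for b
  proof -
    have skew': "cnj (b $ j $ i) = - b $ i $ j" for i j
      using arg_cong[OF skew, of "\<lambda>A. A $ i $ j"] by (simp add: adj_def)
    have re: "Re (b $ j $ i) = - Re (b $ i $ j)" and im: "Im (b $ j $ i) = Im (b $ i $ j)" for i j
      using arg_cong[OF skew'[of j i], of Re] arg_cong[OF skew'[of j i], of Im] by simp_all
    have re0: "Re (b $ i $ i) = 0" for i using re[of i i] by simp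
    define x where "x i j = Re (b $ i $ j)" for i j
    define y where "y i j = Im (b $ i $ j)" for i j
    have x_sym: "(x j i)\<^sup>2 = (x i j)\<^sup>2" and y_sym: "(y j i)\<^sup>2 = (y i j)\<^sup>2" for i j
      using re[of j i] im[of j i] by (simp_all add: x_def y_def)
    have x0: "x i i = 0" for i by (simp add: x_def re0)
    note lower = x_sym[of 2 1] x_sym[of 3 1] x_sym[of 4 1] x_sym[of 3 2] x_sym[of 4 2] x_sym[of 4 3] x0
      y_sym[of 2 1] y_sym[of 3 1] y_sym[of 4 1] y_sym[of 3 2] y_sym[of 4 2] y_sym[of 4 3]
    \<comment> \<open>The squared modulus of the entry at i, j of b D + D b^T with D =
      \<open>diag d\<close>: since b is skew-Hermitian, its real part carries d j - d i and its
      imaginary part d j + d i.\<close>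
    define K where "K i j = (d j - d i)\<^sup>2 * (x i j)\<^sup>2 + (d j + d i)\<^sup>2 * (y i j)\<^sup>2" for i j
    have K_sym: "K j i = K i j" for i j
      unfolding K_def x_sym[of j i] y_sym[of j i] by (simp add: power2_commute add.commute)
    have K_diag: "K i i = 4 * (d i)\<^sup>2 * (y i i)\<^sup>2" for i
      by (simp add: K_def power2_eq_square)
    define T where "T i j g = K i j + g * ((x i j)\<^sup>2 + (y i j)\<^sup>2)" for i j g
    define Y where "Y = (4*(d 1)\<^sup>2 + 2*h1) * (y 1 1)\<^sup>2 + (4*(d 2)\<^sup>2 + 2*h2) * (y 2 2)\<^sup>2 +
      (4*(d 3)\<^sup>2 + 2*h3) * (y 3 3)\<^sup>2 + (4*(d 4)\<^sup>2 + 2*h4) * (y 4 4)\<^sup>2"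
    have N: "(norm (b ** diag d + diag d ** transpose b))\<^sup>2 + 2 * (\<Sum>i\<in>UNIV. h i * (norm (b $ i))\<^sup>2) =
      Y + 2 * (T 1 2 (h1 + h2) + T 1 3 (h1 + h3) + T 1 4 (h1 + h4) + T 2 3 (h2 + h3) + T 2 4 (h2 + h4) + T 3 4 (h3 + h4))"
    proof -
      have "Re ((b ** diag d + diag d ** transpose b) $ i $ j) = (d j - d i) * x i j"
        "Im ((b ** diag d + diag d ** transpose b) $ i $ j) = (d j + d i) * y i j" for i j
        by (simp_all add: mult_diag_nth diag_mult_nth transpose_def re[of j i] im[of j i] x_def y_def algebra_simps)
      then have M: "(norm (b ** diag d + diag d ** transpose b))\<^sup>2 = (\<Sum>i\<in>UNIV. \<Sum>j\<in>UNIV. K i j)"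
        unfolding power2_norm_matrix by (simp add: K_def power_mult_distrib)
      have row: "(norm (b $ i))\<^sup>2 = (\<Sum>j\<in>UNIV. (x i j)\<^sup>2 + (y i j)\<^sup>2)" for i
        unfolding power2_norm_eq_inner by (simp add: inner_vec_def inner_complex_def x_def y_def power2_eq_square)
      show ?thesis
        unfolding M row sum_4 h K_sym[of 2 1] K_sym[of 3 1] K_sym[of 4 1] K_sym[of 3 2] K_sym[of 4 2]
          K_sym[of 4 3] K_diag lower Y_def T_def by (simp only: power_zero_numeral) (simp only: algebra_simps)
    qed
    have b2: "(norm b)\<^sup>2 = ((y 1 1)\<^sup>2 + (y 2 2)\<^sup>2 + (y 3 3)\<^sup>2 + (y 4 4)\<^sup>2) + 2 * (((x 1 2)\<^sup>2 + (y 1 2)\<^sup>2)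
      + ((x 1 3)\<^sup>2 + (y 1 3)\<^sup>2) + ((x 1 4)\<^sup>2 + (y 1 4)\<^sup>2) + ((x 2 3)\<^sup>2 + (y 2 3)\<^sup>2)
      + ((x 2 4)\<^sup>2 + (y 2 4)\<^sup>2) + ((x 3 4)\<^sup>2 + (y 3 4)\<^sup>2))"
      unfolding power2_norm_matrix by (simp add: sum_4 lower flip: x_def y_def)
    have s: "(norm (diag d))\<^sup>2 = s"
      unfolding power2_norm_matrix by (simp add: sum_4 diag_def s_def)
    have trY: "y 1 1 + y 2 2 + y 3 3 + y 4 4 = 0"
      using arg_cong[OF tr, of Im] by (simp add: trace_def sum_4 y_def)
    have Y: "0 \<le> Y" "Y \<le> 2 * s * ((y 1 1)\<^sup>2 + (y 2 2)\<^sup>2 + (y 3 3)\<^sup>2 + (y 4 4)\<^sup>2)"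
      unfolding Y_def
      by (rule diagonal_form[OF trY h_defs PQR bounds[folded s_def] s_def])+
    have T: "0 \<le> T i j g \<and> T i j g \<le> 2 * s * ((x i j)\<^sup>2 + (y i j)\<^sup>2)"
      if "- (d i - d j)\<^sup>2 \<le> g" "g \<le> (d k - d l)\<^sup>2" "s = (d i)\<^sup>2 + (d j)\<^sup>2 + (d k)\<^sup>2 + (d l)\<^sup>2" for i j k l g
      unfolding T_def K_def that(3) using off_diag_bounds[OF d d that(1,2)] by simp
    have T': "0 \<le> T 1 2 (h1 + h2) \<and> T 1 2 (h1 + h2) \<le> 2 * s * ((x 1 2)\<^sup>2 + (y 1 2)\<^sup>2)"
      "0 \<le> T 1 3 (h1 + h3) \<and> T 1 3 (h1 + h3) \<le> 2 * s * ((x 1 3)\<^sup>2 + (y 1 3)\<^sup>2)"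
      "0 \<le> T 1 4 (h1 + h4) \<and> T 1 4 (h1 + h4) \<le> 2 * s * ((x 1 4)\<^sup>2 + (y 1 4)\<^sup>2)"
      "0 \<le> T 2 3 (h2 + h3) \<and> T 2 3 (h2 + h3) \<le> 2 * s * ((x 2 3)\<^sup>2 + (y 2 3)\<^sup>2)"
      "0 \<le> T 2 4 (h2 + h4) \<and> T 2 4 (h2 + h4) \<le> 2 * s * ((x 2 4)\<^sup>2 + (y 2 4)\<^sup>2)"
      "0 \<le> T 3 4 (h3 + h4) \<and> T 3 4 (h3 + h4) \<le> 2 * s * ((x 3 4)\<^sup>2 + (y 3 4)\<^sup>2)"
      using T[of 1 2 "h1 + h2" 3 4] T[of 1 3 "h1 + h3" 2 4] T[of 1 4 "h1 + h4" 2 3]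
        T[of 2 3 "h2 + h3" 1 4] T[of 2 4 "h2 + h4" 1 3] T[of 3 4 "h3 + h4" 1 2] pqr
      by (simp_all add: h_sums s_def power2_commute)
    show ?thesis
      unfolding N b2 s using Y T' by (simp add: distrib_left)
  qed
  moreover have "sum h UNIV = 0"
    using h_sums by (simp add: sum_4)
  ultimately show ?thesis
    by blast
qed

lemma symmetric_matrix_form_bounds:
  fixes S :: "complex^4^4"
  assumes S: "transpose S = S"
  obtains U :: "complex^4^4" and h :: "4 \<Rightarrow> real" where
    "adj U ** U = mat 1" "sum h UNIV = 0"
    "\<And>a. adj a = - a \<Longrightarrow> trace a = 0 \<Longrightarrow>
      (norm (a ** S + S ** transpose a))\<^sup>2 + 2 * (\<Sum>i\<in>UNIV. h i * (norm ((adj U ** a ** U) $ i))\<^sup>2)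
        \<in> {0..2 * (norm S)\<^sup>2 * (norm a)\<^sup>2}"
proof -
  obtain V :: "complex^4^4" and d where V: "adj V ** V = mat 1" and d: "\<And>i. 0 \<le> d i"
    and D: "transpose V ** S ** V = diag d"
    by (rule takagi[OF S]) blast
  obtain h where h: "sum h UNIV = 0" and bounds: "\<And>b. adj b = - b \<Longrightarrow> trace b = 0 \<Longrightarrow>
      (norm (b ** diag d + diag d ** transpose b))\<^sup>2 + 2 * (\<Sum>i\<in>UNIV. h i * (norm (b $ i))\<^sup>2)
        \<in> {0..2 * (norm (diag d))\<^sup>2 * (norm b)\<^sup>2}"
    using diagonal_matrix_form_bounds[of d, OF d] by blast
  \<comment> \<open>The entrywise conjugate of V. Thus b = V^T a U satisfies b D + D b^T = V^T (a S
    + S a^T) V, where D = V^T S V.\<close>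
  define U where "U = transpose (adj V)"
  have V': "V ** adj V = mat 1"
    using V by (simp add: matrix_left_right_inverse)
  have adjU: "adj U = transpose V"
    by (simp add: U_def adj_transpose)
  have transU: "transpose U = adj V"
    by (simp add: U_def)
  have U: "adj U ** U = mat 1"
    unfolding adjU using arg_cong[OF V, of transpose] by (simp add: U_def matrix_transpose_mul)
  have U': "U ** adj U = mat 1"
    using U by (simp add: matrix_left_right_inverse)
  have "(norm (a ** S + S ** transpose a))\<^sup>2 + 2 * (\<Sum>i\<in>UNIV. h i * (norm ((adj U ** a ** U) $ i))\<^sup>2)
        \<in> {0..2 * (norm S)\<^sup>2 * (norm a)\<^sup>2}"
    if a: "adj a = - a" "trace a = 0" for a
  proof -
    define b where "b = adj U ** a ** U"
    have "adj b = - b"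
      by (simp add: b_def adj_mul a matrix_mult_minus matrix_mul_assoc)
    moreover have "trace b = 0"
      using trace_mul_sym[of "adj U" "a ** U"] by (simp add: b_def matrix_mul_assoc[symmetric] U' a)
    moreover have "b ** diag d + diag d ** transpose b = transpose V ** (a ** S + S ** transpose a) ** V"
    proof -
      have 1: "b ** diag d = transpose V ** (a ** S) ** V"
      proof -
        have "b ** diag d = adj U ** a ** (U ** adj U) ** S ** V"
          by (simp only: b_def D[symmetric] adjU matrix_mul_assoc)
        then show ?thesis unfolding U' by (simp add: adjU matrix_mul_assoc)
      qed
      have 2: "diag d ** transpose b = transpose V ** (S ** transpose a) ** V"
      proof -
        have "diag d ** transpose b = transpose V ** S ** (V ** adj V) ** transpose a ** V"
          by (simp add: b_def D[symmetric] adjU transU matrix_transpose_mul matrix_mul_assoc)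
        then show ?thesis by (simp add: V' matrix_mul_assoc)
      qed
      show ?thesis
        unfolding 1 2 by (simp add: matrix_add_ldistrib matrix_mult_add_left)
    qed
    moreover have nV: "norm (transpose V ** X ** V) = norm X" for X
      unfolding norm_eq_sqrt_inner adjU[symmetric]
      by (subst inner_unitary_mult) (simp_all add: U' V')
    moreover have "norm (diag d) = norm S"
      unfolding D[symmetric] by (rule nV)
    moreover have "norm b = norm a"
      unfolding norm_eq_sqrt_inner b_def by (subst inner_unitary_mult) (simp_all add: U')
    ultimately show ?thesis
      using bounds[of b] unfolding b_def by simp
  qed
  then show thesis
    by (rule that[OF U h])
qed

section \<open>The half-spin representation in coordinates\<close>

lemma vector_4:
  "(vector [a, b, c, d] :: 'a::zero^4) $ 1 = a" "(vector [a, b, c, d] :: 'a^4) $ 2 = b"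
  "(vector [a, b, c, d] :: 'a^4) $ 3 = c" "(vector [a, b, c, d] :: 'a^4) $ 4 = d"
  by (simp_all add: vector_def)

lemma sum_lessThan_6: "sum f {..<6::nat} = f 0 + f 1 + f 2 + f 3 + f 4 + f 5"
  by (simp add: eval_nat_numeral)

text \<open>
  With \<open>z\<^sub>1 = x\<^sub>0 + \<i> x\<^sub>1\<close>, \<open>z\<^sub>2 = x\<^sub>2 + \<i> x\<^sub>3\<close>, \<open>z\<^sub>3 = x\<^sub>4 + \<i> x\<^sub>5\<close> let \<open>E(x)\<close> be the skew matrix with
  rows \<open>(0, z\<^sub>1, z\<^sub>2, z\<^sub>3)\<close>, \<open>(-z\<^sub>1, 0, cnj z\<^sub>3, -cnj z\<^sub>2)\<close>, \<open>(-z\<^sub>2, -cnj z\<^sub>3, 0, cnj z\<^sub>1)\<close>,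
  \<open>(-z\<^sub>3, cnj z\<^sub>2, -cnj z\<^sub>1, 0)\<close>, so that \<open>E(x) E(y)\<^sup>* + E(y) E(x)\<^sup>* = 2 (x \<bullet> y)\<close>. The two matrices below are
  \<open>\<Sum>i<j. A i j E\<^sub>i E\<^sub>j\<^sup>*\<close> and \<open>\<Sum>i<j<k. w i j k E\<^sub>i E\<^sub>j\<^sup>* E\<^sub>k\<close>, twice the isometric normalisation.
\<close>

definition spin_matrix :: "(nat \<Rightarrow> nat \<Rightarrow> real) \<Rightarrow> complex^4^4"
  where "spin_matrix A = vector [
    vector [Complex (0) (- A 0 1 - A 2 3 - A 4 5),
      Complex (A 2 4 - A 3 5) (A 2 5 + A 3 4),
      Complex (- A 0 4 + A 1 5) (- A 0 5 - A 1 4),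
      Complex (A 0 2 - A 1 3) (A 0 3 + A 1 2)],
    vector [Complex (- A 2 4 + A 3 5) (A 2 5 + A 3 4),
      Complex (0) (- A 0 1 + A 2 3 + A 4 5),
      Complex (A 0 2 + A 1 3) (- A 0 3 + A 1 2),
      Complex (A 0 4 + A 1 5) (- A 0 5 + A 1 4)],
    vector [Complex (A 0 4 - A 1 5) (- A 0 5 - A 1 4),
      Complex (- A 0 2 - A 1 3) (- A 0 3 + A 1 2),
      Complex (0) (A 0 1 - A 2 3 + A 4 5),
      Complex (A 2 4 + A 3 5) (- A 2 5 + A 3 4)],
    vector [Complex (- A 0 2 + A 1 3) (A 0 3 + A 1 2),
      Complex (- A 0 4 - A 1 5) (- A 0 5 + A 1 4),
      Complex (- A 2 4 - A 3 5) (- A 2 5 + A 3 4),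
      Complex (0) (A 0 1 + A 2 3 - A 4 5)]]"

definition sym_matrix :: "(nat \<Rightarrow> nat \<Rightarrow> nat \<Rightarrow> real) \<Rightarrow> complex^4^4"
  where "sym_matrix w = vector [
    vector [Complex (- w 0 2 4 + w 0 3 5 + w 1 2 5 + w 1 3 4) (- w 0 2 5 - w 0 3 4 - w 1 2 4 + w 1 3 5),
      Complex (w 1 2 3 + w 1 4 5) (- w 0 2 3 - w 0 4 5),
      Complex (w 0 1 3 + w 3 4 5) (- w 0 1 2 - w 2 4 5),
      Complex (w 0 1 5 + w 2 3 5) (- w 0 1 4 - w 2 3 4)],
    vector [Complex (w 1 2 3 + w 1 4 5) (- w 0 2 3 - w 0 4 5),
      Complex (- w 0 2 4 + w 0 3 5 - w 1 2 5 - w 1 3 4) (w 0 2 5 + w 0 3 4 - w 1 2 4 + w 1 3 5),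
      Complex (- w 0 1 5 + w 2 3 5) (- w 0 1 4 + w 2 3 4),
      Complex (w 0 1 3 - w 3 4 5) (w 0 1 2 - w 2 4 5)],
    vector [Complex (w 0 1 3 + w 3 4 5) (- w 0 1 2 - w 2 4 5),
      Complex (- w 0 1 5 + w 2 3 5) (- w 0 1 4 + w 2 3 4),
      Complex (- w 0 2 4 - w 0 3 5 + w 1 2 5 - w 1 3 4) (w 0 2 5 - w 0 3 4 + w 1 2 4 + w 1 3 5),
      Complex (- w 1 2 3 + w 1 4 5) (- w 0 2 3 + w 0 4 5)],
    vector [Complex (w 0 1 5 + w 2 3 5) (- w 0 1 4 - w 2 3 4),
      Complex (w 0 1 3 - w 3 4 5) (w 0 1 2 - w 2 4 5),
      Complex (- w 1 2 3 + w 1 4 5) (- w 0 2 3 + w 0 4 5),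
      Complex (- w 0 2 4 - w 0 3 5 - w 1 2 5 + w 1 3 4) (- w 0 2 5 + w 0 3 4 + w 1 2 4 + w 1 3 5)]]"

lemma adj_spin_matrix: "adj (spin_matrix A) = - spin_matrix A"
  by (simp add: vec_eq_iff forall_4 adj_def spin_matrix_def vector_4 complex_eq_iff)

lemma trace_spin_matrix: "trace (spin_matrix A) = 0"
  by (simp add: trace_def sum_4 spin_matrix_def vector_4 complex_eq_iff)

lemma transpose_sym_matrix: "transpose (sym_matrix w) = sym_matrix w"
  by (simp add: vec_eq_iff forall_4 transpose_def sym_matrix_def vector_4 complex_eq_iff)

text \<open>The products of E_i with the adjoint of E_j, i < j, are mutually orthogonal with squared
  norm 4, and the double sum counts each pair twice.\<close>

lemma norm_spin_matrix:
  assumes A: "\<And>i j. A j i = - A i j"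
  shows "(norm (spin_matrix A))\<^sup>2 = 2 * (\<Sum>i<6. \<Sum>j<6. (A i j)\<^sup>2)"
proof -
  have A0: "A i i = 0" for i using A[of i i] by simp
  \<comment> \<open>The order condition makes skew symmetry a terminating rewrite rule that sorts
    the indices.\<close>
  have A_less: "j < i \<Longrightarrow> A i j = - A j i" for i j by (rule A)
  show ?thesis
    unfolding power2_norm_matrix
    by (simp add: sum_4 sum_lessThan_6 spin_matrix_def vector_4 A_less A0)
      (simp add: power2_eq_square algebra_simps)
qed

lemma norm_sym_matrix:
  assumes w: "\<And>i j k. w j i k = - w i j k" "\<And>i j k. w i k j = - w i j k"
  shows "3 * (norm (sym_matrix w))\<^sup>2 = 2 * (\<Sum>i<6. \<Sum>j<6. \<Sum>k<6. (w i j k)\<^sup>2)"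
proof -
  have w0: "w i i k = 0" "w i k k = 0" "w i k i = 0" for i k
    using w(1)[of i i k] w(2)[of i k k] w(1)[of i k i] w(2)[of k i i] by simp_all
  have w_less: "j < i \<Longrightarrow> w i j k = - w j i k" "k < j \<Longrightarrow> w i j k = - w i k j" for i j k
    by (rule w)+
  show ?thesis
    unfolding power2_norm_matrix
    by (simp add: sum_4 sum_lessThan_6 sym_matrix_def vector_4 w_less w0)
      (simp add: power2_eq_square algebra_simps)
qed

text \<open>Infinitesimal equivariance of the half-spin representation, checked entrywise as
  polynomial identities. The factor 2 appears because neither matrix is normalised to be
  isometric.\<close>

lemma sym_matrix_act:
  assumes A: "\<And>i j. A j i = - A i j"
    and w: "\<And>i j k. w j i k = - w i j k" "\<And>i j k. w i k j = - w i j k"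
  shows "2 *\<^sub>R sym_matrix (\<lambda>i j k. \<Sum>l<6. A i l * w l j k + A j l * w i l k + A k l * w i j l)
    = spin_matrix A ** sym_matrix w + sym_matrix w ** transpose (spin_matrix A)"
proof -
  have A0: "A i i = 0" for i using A[of i i] by simp
  have A_less: "j < i \<Longrightarrow> A i j = - A j i" for i j by (rule A)
  have w0: "w i i k = 0" "w i k k = 0" "w i k i = 0" for i k
    using w(1)[of i i k] w(2)[of i k k] w(1)[of i k i] w(2)[of k i i] by simp_all
  have w_less: "j < i \<Longrightarrow> w i j k = - w j i k" "k < j \<Longrightarrow> w i j k = - w i k j" for i j k
    by (rule w)+
  define T where "T = (\<lambda>i j k. \<Sum>l<6. A i l * w l j k + A j l * w i l k + A k l * w i j l)"
  have T: "T i j k = A i 0 * w 0 j k + A j 0 * w i 0 k + A k 0 * w i j 0 +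
      (A i 1 * w 1 j k + A j 1 * w i 1 k + A k 1 * w i j 1) +
      (A i 2 * w 2 j k + A j 2 * w i 2 k + A k 2 * w i j 2) +
      (A i 3 * w 3 j k + A j 3 * w i 3 k + A k 3 * w i j 3) +
      (A i 4 * w 4 j k + A j 4 * w i 4 k + A k 4 * w i j 4) +
      (A i 5 * w 5 j k + A j 5 * w i 5 k + A k 5 * w i j 5)" for i j k
    by (simp add: T_def sum_lessThan_6)
  show ?thesis
    unfolding T_def[symmetric]
    by (simp only: vec_eq_iff forall_4 matrix_matrix_mult_def sum_4 transpose_def spin_matrix_def
        sym_matrix_def vector_4 complex_eq_iff complex.sel times_complex.sel plus_complex.sel
        scaleR_complex.sel vector_scaleR_component vector_add_component vec_lambda_beta, intro conjI;
        simp add: T w_less w0 A_less A0; algebra)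
qed

text \<open>For orthogonal x and y the matrix is E(x) times the adjoint of E(y), a multiple of a
  unitary matrix. In general only the component of y orthogonal to x matters, and the scalar is the
  Gram determinant. This makes traceless Hermitian forms vanish on decomposable bivectors.\<close>

lemma spin_matrix_simple:
  fixes x y :: "nat \<Rightarrow> real"
  obtains c where "spin_matrix (\<lambda>i j. x i * y j - y i * x j) ** adj (spin_matrix (\<lambda>i j. x i * y j - y i * x j)) = c *\<^sub>R mat 1"
proof
  show "spin_matrix (\<lambda>i j. x i * y j - y i * x j) ** adj (spin_matrix (\<lambda>i j. x i * y j - y i * x j)) =
      ((\<Sum>i<6. (x i)\<^sup>2) * (\<Sum>i<6. (y i)\<^sup>2) - (\<Sum>i<6. x i * y i)\<^sup>2) *\<^sub>R mat 1"
    by (simp only: vec_eq_iff forall_4 matrix_matrix_mult_def sum_4 adj_def spin_matrix_def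
        vector_4 complex_eq_iff complex.sel times_complex.sel plus_complex.sel cnj.sel sum_lessThan_6
        scaleR_complex.sel vector_scaleR_component vec_lambda_beta mat_def, intro conjI;
        simp; algebra)
qed

section \<open>From six-dimensional space to matrices\<close>

lemma wedge_linear:
  "(x + y) \<and>\<^sub>V z = x \<and>\<^sub>V z + y \<and>\<^sub>V z" "z \<and>\<^sub>V (x + y) = z \<and>\<^sub>V x + z \<and>\<^sub>V y"
  "(c *\<^sub>R x) \<and>\<^sub>V z = c *\<^sub>R (x \<and>\<^sub>V z)" "z \<and>\<^sub>V (c *\<^sub>R x) = c *\<^sub>R (z \<and>\<^sub>V x)"
  by (rule so_eqI; simp add: wedge.rep_eq algebra_simps)+

lemma wedge_anticomm: "y \<and>\<^sub>V x = - (x \<and>\<^sub>V y)"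
  by (rule so_eqI) (simp add: wedge.rep_eq)

lemma wedge_self [simp]: "x \<and>\<^sub>V x = 0"
  by (rule so_eqI) (simp add: wedge.rep_eq)

text \<open>Polarising \<open>null\<close> in one factor gives \<open>B (x \<and>\<^sub>V y) (x \<and>\<^sub>V z) = 0\<close>, that is, the alternation of
  \<open>B (x \<and>\<^sub>V y) (z \<and>\<^sub>V w)\<close> across the two factors.\<close>

lemma four_form_of_bilinear:
  fixes B :: "'a::euclidean_space so \<Rightarrow> 'a so \<Rightarrow> real"
  assumes lin: "\<And>\<beta>. linear (\<lambda>\<alpha>. B \<alpha> \<beta>)" and sym: "\<And>\<alpha> \<beta>. B \<alpha> \<beta> = B \<beta> \<alpha>"
    and null: "\<And>x y. B (x \<and>\<^sub>V y) (x \<and>\<^sub>V y) = 0"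
  obtains \<eta> where "\<eta> \<in> forms 4" "\<And>\<alpha> \<beta>. hat_op \<eta> \<alpha> \<bullet> \<beta> = B \<alpha> \<beta>"
proof
  define \<eta> where "\<eta> xs = (if length xs = 4 then B (xs ! 0 \<and>\<^sub>V xs ! 1) (xs ! 2 \<and>\<^sub>V xs ! 3) else 0)" for xs
  have lin': "linear (B \<alpha>)" for \<alpha>
  proof -
    have "B \<alpha> = (\<lambda>\<beta>. B \<beta> \<alpha>)" using sym by auto
    then show ?thesis using lin by simp
  qed
  note B_simps = linear_add[OF lin] linear_add[OF lin'] linear_cmul[OF lin] linear_cmul[OF lin']
    linear_neg[OF lin] linear_neg[OF lin'] linear_0[OF lin] linear_0[OF lin']
  have repeat: "B (x \<and>\<^sub>V y) (x \<and>\<^sub>V z) = 0" for x y z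
    using null[of x "y + z"] by (simp add: wedge_linear B_simps null sym[of "x \<and>\<^sub>V z" "x \<and>\<^sub>V y"])
  have repeat': "B (y \<and>\<^sub>V x) (x \<and>\<^sub>V z) = 0" "B (x \<and>\<^sub>V y) (z \<and>\<^sub>V x) = 0" "B (y \<and>\<^sub>V x) (z \<and>\<^sub>V x) = 0" for x y z
    by (simp_all only: wedge_anticomm[of y x] wedge_anticomm[of z x] B_simps repeat minus_zero)
  show forms: "\<eta> \<in> forms 4"
    unfolding forms_def
  proof (intro CollectI conjI allI impI)
    fix xs :: "'a list" and i :: nat assume "length xs = 4" "i < 4"
    then consider "i = 0" | "i = 1" | "i = 2" | "i = 3" by linarith
    then show "linear (\<lambda>x. \<eta> (xs[i := x]))"
      by cases (use \<open>length xs = 4\<close> in \<open>auto intro!: linearI simp: \<eta>_def wedge_linear B_simps\<close>)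
  next
    fix xs :: "'a list" and i j :: nat assume *: "length xs = 4" "i < j" "j < 4" "xs ! i = xs ! j"
    then consider "i = 0" "j = 1" | "i = 0" "j = 2" | "i = 0" "j = 3" | "i = 1" "j = 2" | "i = 1" "j = 3"
      | "i = 2" "j = 3" by linarith
    then show "\<eta> xs = 0"
      by cases (use *(1,4) in \<open>auto simp: \<eta>_def B_simps repeat repeat'\<close>)
  qed (simp add: \<eta>_def)
  show "hat_op \<eta> \<alpha> \<bullet> \<beta> = B \<alpha> \<beta>" for \<alpha> \<beta>
  proof -
    note hat = linear_hat_op[OF forms]
    have wedge: "hat_op \<eta> (x \<and>\<^sub>V y) \<bullet> (z \<and>\<^sub>V w) = B (x \<and>\<^sub>V y) (z \<and>\<^sub>V w)" for x y z w
      by (simp add: inner_hat_op[OF forms] \<eta>_def numeral_2_eq_2 numeral_3_eq_3)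
    have "(\<lambda>\<beta>. hat_op \<eta> (x \<and>\<^sub>V y) \<bullet> \<beta>) = B (x \<and>\<^sub>V y)" for x y
      by (rule linear_eq_wedge) (simp_all add: wedge linear_iff inner_add_right B_simps)
    then have 1: "hat_op \<eta> (x \<and>\<^sub>V y) \<bullet> \<beta> = B (x \<and>\<^sub>V y) \<beta>" for x y
      by metis
    have "(\<lambda>\<alpha>. hat_op \<eta> \<alpha> \<bullet> \<beta>) = (\<lambda>\<alpha>. B \<alpha> \<beta>)"
      by (rule linear_eq_wedge)
        (simp_all add: 1 linear_iff inner_add_left B_simps linear_add[OF hat] linear_cmul[OF hat])
    then show ?thesis by metis
  qed
qed

lemma sum_lists_length_3:
  "(\<Sum>xs | set xs \<subseteq> A \<and> length xs = 3. f xs) = (\<Sum>a\<in>A. \<Sum>b\<in>A. \<Sum>c\<in>A. f [a, b, c])"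
proof -
  have eq: "{xs. set xs \<subseteq> A \<and> length xs = 3} = (\<lambda>(a, b, c). [a, b, c]) ` (A \<times> A \<times> A)"
    by (force simp: numeral_3_eq_3 length_Suc_conv)
  show ?thesis
    unfolding eq by (subst sum.reindex) (auto simp: inj_on_def sum.cartesian_product split_beta)
qed

lemma
  assumes "\<omega> \<in> forms 3"
  shows forms_3_linear: "linear (\<lambda>x. \<omega> [x, y, z])" "linear (\<lambda>y. \<omega> [x, y, z])" "linear (\<lambda>z. \<omega> [x, y, z])"
    and forms_3_swap: "\<omega> [y, x, z] = - \<omega> [x, y, z]" "\<omega> [x, z, y] = - \<omega> [x, y, z]"
proof -
  have lin: "linear (\<lambda>x. \<omega> (xs[i := x]))" if "length xs = 3" "i < 3" for xs i
    using assms that unfolding forms_def by blast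
  have alt: "\<omega> xs = 0" if "length xs = 3" "i < j" "j < 3" "xs ! i = xs ! j" for xs i j
    using assms that unfolding forms_def by blast
  show 1: "linear (\<lambda>x. \<omega> [x, y, z])" for y z using lin[of "[0, y, z]" 0] by simp
  show 2: "linear (\<lambda>y. \<omega> [x, y, z])" for x z using lin[of "[x, 0, z]" 1] by simp
  show 3: "linear (\<lambda>z. \<omega> [x, y, z])" for x y using lin[of "[x, y, 0]" 2] by (simp add: numeral_2_eq_2)
  have a: "\<omega> [x, x, z] = 0" for x z using alt[of "[x, x, z]" 0 1] by simp
  have b: "\<omega> [x, z, z] = 0" for x z using alt[of "[x, z, z]" 1 2] by (simp add: numeral_2_eq_2)
  show "\<omega> [y, x, z] = - \<omega> [x, y, z]"
    using a[of "x + y" z] unfolding linear_add[OF 1] linear_add[OF 2] by (simp add: a)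
  show "\<omega> [x, z, y] = - \<omega> [x, y, z]"
    using b[of x "y + z"] unfolding linear_add[OF 2] linear_add[OF 3] by (simp add: b)
qed

section \<open>Orthonormal coordinates in dimension six\<close>

locale six_dim =
  fixes e :: "nat \<Rightarrow> 'a::euclidean_space"
  assumes bij: "bij_betw e {..<6} Basis"
begin

lemma sum_Basis: "(\<Sum>u\<in>Basis. f u) = (\<Sum>i<6. f (e i))"
  using sum.reindex_bij_betw[OF bij, of f] by simp

definition so_coord :: "'a so \<Rightarrow> nat \<Rightarrow> nat \<Rightarrow> real"
  where "so_coord \<alpha> i j = so_apply \<alpha> (e i) \<bullet> e j"

lemma so_coord_skew: "so_coord \<alpha> j i = - so_coord \<alpha> i j"
  unfolding so_coord_def by (metis skew_so_apply inner_commute)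

lemma so_coord_wedge: "so_coord (x \<and>\<^sub>V y) = (\<lambda>i j. (x \<bullet> e i) * (y \<bullet> e j) - (y \<bullet> e i) * (x \<bullet> e j))"
  by (simp add: so_coord_def wedge.rep_eq inner_diff_left fun_eq_iff)

lemma so_apply_coord: "so_apply \<alpha> (e i) = (\<Sum>l<6. so_coord \<alpha> i l *\<^sub>R e l)"
  using euclidean_representation[of "so_apply \<alpha> (e i)"] by (simp add: sum_Basis so_coord_def)

lemma inner_so_coord: "\<alpha> \<bullet> \<alpha> = (\<Sum>i<6. \<Sum>j<6. (so_coord \<alpha> i j)\<^sup>2) / 2"
proof -
  have "v \<bullet> v = (\<Sum>j<6. (v \<bullet> e j)\<^sup>2)" for v :: 'a
    by (simp add: euclidean_inner[of v v] power2_eq_square sum_Basis)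
  then show ?thesis
    by (simp add: inner_so_def sum_Basis so_coord_def)
qed

definition spinor :: "'a so \<Rightarrow> complex^4^4"
  where "spinor \<alpha> = (1 / 2) *\<^sub>R spin_matrix (so_coord \<alpha>)"

lemma linear_spinor: "linear spinor"
  by (rule linearI)
    (simp_all add: spinor_def spin_matrix_def so_coord_def inner_add_left vec_eq_iff forall_4 vector_4
      complex_eq_iff algebra_simps)

lemma norm_spinor: "(norm (spinor \<alpha>))\<^sup>2 = \<alpha> \<bullet> \<alpha>"
  unfolding spinor_def norm_scaleR power_mult_distrib norm_spin_matrix[OF so_coord_skew] inner_so_coord
  by (simp add: power2_eq_square)

lemma adj_spinor: "adj (spinor \<alpha>) = - spinor \<alpha>"
  by (simp add: spinor_def adj_scaleR adj_spin_matrix)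

lemma trace_spinor: "trace (spinor \<alpha>) = 0"
  using trace_spin_matrix[of "so_coord \<alpha>"]
  by (simp add: spinor_def trace_def flip: scaleR_sum_right)

lemma spinor_wedge:
  obtains c where "spinor (x \<and>\<^sub>V y) ** adj (spinor (x \<and>\<^sub>V y)) = c *\<^sub>R mat 1"
proof -
  obtain c where "spin_matrix (so_coord (x \<and>\<^sub>V y)) ** adj (spin_matrix (so_coord (x \<and>\<^sub>V y))) = c *\<^sub>R mat 1"
    unfolding so_coord_wedge by (rule spin_matrix_simple)
  then show thesis
    by (intro that[of "c / 4"]) (simp add: spinor_def adj_scaleR matrix_mult_scaleR)
qed

definition symm :: "('a list \<Rightarrow> real) \<Rightarrow> complex^4^4"
  where "symm \<omega> = (1 / 2) *\<^sub>R sym_matrix (\<lambda>i j k. \<omega> [e i, e j, e k])"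

lemma transpose_symm: "transpose (symm \<omega>) = symm \<omega>"
  using transpose_sym_matrix unfolding symm_def transpose_def vec_eq_iff by simp

lemma form_inner_coord:
  "form_inner 3 \<theta> \<theta> = (\<Sum>i<6. \<Sum>j<6. \<Sum>k<6. (\<theta> [e i, e j, e k])\<^sup>2) / 6"
  by (simp add: form_inner_def sum_lists_length_3 sum_Basis power2_eq_square fact_numeral)

lemma norm_symm:
  assumes "\<And>x y z. \<theta> [y, x, z] = - \<theta> [x, y, z]" "\<And>x y z. \<theta> [x, z, y] = - \<theta> [x, y, z]"
  shows "(norm (symm \<theta>))\<^sup>2 = form_inner 3 \<theta> \<theta>"
proof -
  have "3 * (norm (sym_matrix (\<lambda>i j k. \<theta> [e i, e j, e k])))\<^sup>2 = 2 * (\<Sum>i<6. \<Sum>j<6. \<Sum>k<6. (\<theta> [e i, e j, e k])\<^sup>2)"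
    by (rule norm_sym_matrix) (rule assms)+
  then show ?thesis
    by (simp add: symm_def form_inner_coord power_mult_distrib power2_eq_square)
qed

lemma so_act_3:
  "so_act \<alpha> \<omega> [x, y, z] = - (\<omega> [so_apply \<alpha> x, y, z] + \<omega> [x, so_apply \<alpha> y, z] + \<omega> [x, y, so_apply \<alpha> z])"
  by (simp add: so_act_def numeral_3_eq_3)

text \<open>By equivariance the matrix on the left is minus
  \<open>symm (so_act \<alpha> \<omega>)\<close>, and the sign disappears in the norm. This puts the
  quadratic form of the action operator in matrix terms.\<close>

lemma norm_so_act:
  assumes \<omega>: "\<omega> \<in> forms 3"
  shows "(norm (spinor \<alpha> ** symm \<omega> + symm \<omega> ** transpose (spinor \<alpha>)))\<^sup>2
    = form_inner 3 (so_act \<alpha> \<omega>) (so_act \<alpha> \<omega>)"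
proof -
  note lin = forms_3_linear[OF \<omega>] and swap = forms_3_swap[OF \<omega>]
  define w where "w i j k = \<omega> [e i, e j, e k]" for i j k
  define A where "A = so_coord \<alpha>"
  have act: "so_act \<alpha> \<omega> [e i, e j, e k] = - (\<Sum>l<6. A i l * w l j k + A j l * w i l k + A k l * w i j l)" for i j k
    by (simp add: so_act_3 so_apply_coord linear_sum[OF lin(1)] linear_sum[OF lin(2)] linear_sum[OF lin(3)]
        linear_cmul[OF lin(1)] linear_cmul[OF lin(2)] linear_cmul[OF lin(3)] w_def A_def sum.distrib)
  have neg: "sym_matrix (\<lambda>i j k. - T i j k) = - sym_matrix T" for T
    by (simp add: sym_matrix_def vec_eq_iff forall_4 vector_4 complex_eq_iff)
  have act_matrix: "- (2 *\<^sub>R sym_matrix (\<lambda>i j k. so_act \<alpha> \<omega> [e i, e j, e k]))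
      = spin_matrix A ** sym_matrix w + sym_matrix w ** transpose (spin_matrix A)"
  proof -
    have "2 *\<^sub>R sym_matrix (\<lambda>i j k. \<Sum>l<6. A i l * w l j k + A j l * w i l k + A k l * w i j l)
        = spin_matrix A ** sym_matrix w + sym_matrix w ** transpose (spin_matrix A)"
      unfolding A_def w_def by (rule sym_matrix_act) (rule so_coord_skew swap)+
    then show ?thesis
      unfolding act neg by simp
  qed
  have "transpose ((1 / 2) *\<^sub>R M) = (1 / 2) *\<^sub>R transpose M" for M :: "complex^4^4"
    by (simp add: transpose_def vec_eq_iff)
  then have "spinor \<alpha> ** symm \<omega> + symm \<omega> ** transpose (spinor \<alpha>)
      = (1 / 4) *\<^sub>R (spin_matrix A ** sym_matrix w + sym_matrix w ** transpose (spin_matrix A))"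
    by (simp add: spinor_def symm_def A_def w_def[abs_def] matrix_mult_scaleR scaleR_add_right)
  also have "\<dots> = - symm (so_act \<alpha> \<omega>)"
    unfolding act_matrix[symmetric] symm_def by simp
  finally have "spinor \<alpha> ** symm \<omega> + symm \<omega> ** transpose (spinor \<alpha>) = - symm (so_act \<alpha> \<omega>)" .
  moreover have "(norm (symm (so_act \<alpha> \<omega>)))\<^sup>2 = form_inner 3 (so_act \<alpha> \<omega>) (so_act \<alpha> \<omega>)"
  proof (rule norm_symm)
    show "so_act \<alpha> \<omega> [y, x, z] = - so_act \<alpha> \<omega> [x, y, z]" for x y z
      using swap(1)[where x = "so_apply \<alpha> x" and y = y and z = z]
        swap(1)[where x = x and y = "so_apply \<alpha> y" and z = z]
        swap(1)[where x = x and y = y and z = "so_apply \<alpha> z"]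
      unfolding so_act_3 by linarith
    show "so_act \<alpha> \<omega> [x, z, y] = - so_act \<alpha> \<omega> [x, y, z]" for x y z
      using swap(2)[where x = "so_apply \<alpha> x" and y = y and z = z]
        swap(2)[where x = x and y = "so_apply \<alpha> y" and z = z]
        swap(2)[where x = x and y = y and z = "so_apply \<alpha> z"]
      unfolding so_act_3 by linarith
  qed
  ultimately show ?thesis by simp
qed

end

theorem theorem5p1:
  fixes \<omega> :: "'a::euclidean_space list \<Rightarrow> real"
  assumes "DIM('a) = 6"
    and "\<omega> \<in> forms 3"
  shows "\<exists>\<eta>\<in>forms 4.
    (\<lambda>_. 0) \<le>\<^sub>q (\<lambda>\<alpha>. action_op 3 \<omega> \<alpha> + hat_op \<eta> \<alpha>) \<and>
    (\<lambda>\<alpha>. action_op 3 \<omega> \<alpha> + hat_op \<eta> \<alpha>) \<le>\<^sub>q (\<lambda>\<alpha>. (2 * (form_norm 3 \<omega>)\<^sup>2) *\<^sub>R \<alpha>)"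
proof -
  note \<omega> = assms(2)
  obtain e where "bij_betw e {0..<DIM('a)} (Basis :: 'a set)"
    using ex_bij_betw_nat_finite[OF finite_Basis] by blast
  then have "bij_betw e {..<6} Basis"
    by (simp add: assms(1) lessThan_atLeast0)
  then interpret six_dim e by unfold_locales
  obtain U :: "complex^4^4" and h :: "4 \<Rightarrow> real" where U: "adj U ** U = mat 1" and h: "sum h UNIV = 0"
    and bounds: "\<And>a. adj a = - a \<Longrightarrow> trace a = 0 \<Longrightarrow>
      (norm (a ** symm \<omega> + symm \<omega> ** transpose a))\<^sup>2 + 2 * (\<Sum>i\<in>UNIV. h i * (norm ((adj U ** a ** U) $ i))\<^sup>2)
        \<in> {0..2 * (norm (symm \<omega>))\<^sup>2 * (norm a)\<^sup>2}"
    by (rule symmetric_matrix_form_bounds[OF transpose_symm, of \<omega>]) blast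
  define M where "M \<alpha> = adj U ** spinor \<alpha> ** U" for \<alpha>
  \<comment> \<open>The polarisation of 2 tr (H a \<open>adj a\<close>) for a =
    \<open>spinor \<alpha>\<close> and the traceless Hermitian H = U \<open>diag h\<close>
    \<open>adj U\<close>.\<close>
  define B where "B \<alpha> \<beta> = 2 * (\<Sum>i\<in>UNIV. h i * (M \<alpha> $ i \<bullet> M \<beta> $ i))" for \<alpha> \<beta>
  have M_add: "M (\<alpha> + \<beta>) = M \<alpha> + M \<beta>" for \<alpha> \<beta>
    by (simp add: M_def linear_add[OF linear_spinor] matrix_add_ldistrib matrix_mult_add_left)
  have M_scaleR: "M (c *\<^sub>R \<alpha>) = c *\<^sub>R M \<alpha>" for c \<alpha>
    by (simp add: M_def linear_cmul[OF linear_spinor] matrix_mult_scaleR)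
  have lin: "linear (\<lambda>\<alpha>. B \<alpha> \<beta>)" for \<beta>
    by (rule linearI)
      (simp_all add: B_def M_add M_scaleR inner_add_left algebra_simps sum.distrib sum_distrib_left)
  \<comment> \<open>On a decomposable bivector all rows of \<open>M\<close> have the same squared
    norm c, so the form equals 2 c times the sum of \<open>h\<close>, which is 0.\<close>
  have null: "B (x \<and>\<^sub>V y) (x \<and>\<^sub>V y) = 0" for x y
  proof -
    obtain c where c: "spinor (x \<and>\<^sub>V y) ** adj (spinor (x \<and>\<^sub>V y)) = c *\<^sub>R mat 1"
      by (rule spinor_wedge)
    have "U ** adj U = mat 1"
      using U by (simp add: matrix_left_right_inverse)
    have "M (x \<and>\<^sub>V y) ** adj (M (x \<and>\<^sub>V y)) =
        adj U ** (spinor (x \<and>\<^sub>V y) ** (U ** adj U) ** adj (spinor (x \<and>\<^sub>V y))) ** U"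
      by (simp add: M_def adj_mul matrix_mul_assoc)
    also have "\<dots> = c *\<^sub>R mat 1"
      by (simp add: \<open>U ** adj U = mat 1\<close> c matrix_mult_scaleR U)
    finally have "M (x \<and>\<^sub>V y) ** adj (M (x \<and>\<^sub>V y)) = c *\<^sub>R mat 1" .
    then have "Re ((M (x \<and>\<^sub>V y) ** adj (M (x \<and>\<^sub>V y))) $ i $ i) = c" for i
      by (simp add: mat_def)
    then have "M (x \<and>\<^sub>V y) $ i \<bullet> M (x \<and>\<^sub>V y) $ i = c" for i
      by (simp add: matrix_matrix_mult_def adj_def inner_vec_def inner_complex_def)
    then show ?thesis
      using h by (simp add: B_def flip: sum_distrib_right)
  qed
  obtain \<eta> where \<eta>: "\<eta> \<in> forms 4" "\<And>\<alpha> \<beta>. hat_op \<eta> \<alpha> \<bullet> \<beta> = B \<alpha> \<beta>"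
    by (rule four_form_of_bilinear[of B]) (auto simp: lin null, simp add: B_def inner_commute)
  have "0 \<le> (action_op 3 \<omega> \<alpha> + hat_op \<eta> \<alpha>) \<bullet> \<alpha> \<and>
      (action_op 3 \<omega> \<alpha> + hat_op \<eta> \<alpha>) \<bullet> \<alpha> \<le> 2 * (form_norm 3 \<omega>)\<^sup>2 * (\<alpha> \<bullet> \<alpha>)" for \<alpha>
  proof -
    have "(action_op 3 \<omega> \<alpha> + hat_op \<eta> \<alpha>) \<bullet> \<alpha>
        = (norm (spinor \<alpha> ** symm \<omega> + symm \<omega> ** transpose (spinor \<alpha>)))\<^sup>2
          + 2 * (\<Sum>i\<in>UNIV. h i * (norm ((adj U ** spinor \<alpha> ** U) $ i))\<^sup>2)"
      unfolding norm_so_act[OF \<omega>]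
      by (simp add: inner_add_left inner_action_op[OF \<omega>] \<eta>(2) B_def M_def power2_norm_eq_inner)
    moreover have "(form_norm 3 \<omega>)\<^sup>2 = (norm (symm \<omega>))\<^sup>2"
      unfolding form_norm_def norm_symm[of \<omega>, OF forms_3_swap[OF \<omega>], symmetric] by simp
    ultimately show ?thesis
      using bounds[OF adj_spinor trace_spinor, of \<alpha>] by (simp add: norm_spinor)
  qed
  then show ?thesis
    using \<eta>(1) by (auto simp: qf_le_def)
qed

end
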